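(* Let $A$ be a $C^*$-algebra, let $X$ be a semi-inner product $C^*$-module over $A$, and let $p\in A$, $e\in X$ be such that $\langle e,e\rangle$ is an idempotent element of $A$. Put, for functions $f,g:A\to X$ and $t\in A$, $$\langle f(t),g(t)\rangle_1=\langle f(t),g(t)\rangle-\langle f(t),e\rangle\langle e,g(t)\rangle,$$ and more generally $\langle x,y\rangle_1=\langle x,y\rangle-\langle x,e\rangle\langle e,y\rangle$ for $x,y\in X$. Then for every $a\in A$ the map $[\cdot,\cdot]_a:D_p(A,X)\times D_p(A,X)\to A$ given by $$[f,g]_a:=\big\langle Df(p)(a),Dg(p)(a)\big\rangle_1+\big\langle f(p),g(p)\big\rangle_1-D\big\langle f(\cdot),g(\cdot)\big\rangle_1(p)(a)$$ is a generalized semi-inner product on $D_p(A,X)$.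
   Context: A semi-inner product $C^*$-module over a $C^*$-algebra $A$ is a right $A$-module $X$ with a generalized semi-inner product, i.e. a map $\langle\cdot,\cdot\rangle:X\times X\to A$ such that (i) $\langle x,y+z\rangle=\langle x,y\rangle+\langle x,z\rangle$; (ii) $\langle x,ya\rangle=\langle x,y\rangle a$; (iii) $\langle x,y\rangle^*=\langle y,x\rangle$; (iv) $\langle x,x\rangle\ge 0$, for all $x,y,z\in X$, $a\in A$. The (semi)norm on $X$ is $\|x\|=\|\langle x,x\rangle\|^{1/2}$. A function $f:A\to X$ is Fréchet differentiable at $q\in A$ if there is a bounded linear map $u=Df(q):A\to X$ with $\lim_{h\to0}\|f(q+h)-f(q)-u(h)\|/\|h\|=0$. $D_p(A,X)$ denotes the set of all continuous functions $f:A\to X$ that are Fréchet differentiable on an open neighborhood $U$ of $p$. It has pointwise addition and the right $A$-action $f\mapsto f_b$ for $b\in A$, where $f_b(t)=f(t)b$. $D\langle f(\cdot),g(\cdot)\rangle_1(p)$ is the derivative at $p$ of the function $t\mapsto\langle f(t),g(t)\rangle_1$ from $A$ to $A$, where $A$ is regarded as a real normed space for this derivative; it is given by the product rule $D\langle f(\cdot),g(\cdot)\rangle_1(p)(a)=\langle Df(p)(a),g(p)\rangle_1+\langle f(p),Dg(p)(a)\rangle_1$. *)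

theory Defs
  imports "HOL-Analysis.Analysis" "HOL-Library.Function_Algebras" "HOL-Library.Nonpos_Ints"
begin

text \<open>Not necessarily unital. The norm, the completeness and the real scalars come from the
  parent classes.\<close>

class cstar_algebra = real_normed_algebra + complete_space +
  fixes scaleC :: "complex \<Rightarrow> 'a \<Rightarrow> 'a" (infixr "*\<^sub>C" 75)
    and star :: "'a \<Rightarrow> 'a"
  assumes scaleC_add_right: "c *\<^sub>C (x + y) = c *\<^sub>C x + c *\<^sub>C y"
    and scaleC_add_left: "(c + d) *\<^sub>C x = c *\<^sub>C x + d *\<^sub>C x"
    and scaleC_scaleC: "c *\<^sub>C d *\<^sub>C x = (c * d) *\<^sub>C x"
    and scaleC_of_real: "complex_of_real r *\<^sub>C x = r *\<^sub>R x"
    and mult_scaleC_left: "(c *\<^sub>C x) * y = c *\<^sub>C (x * y)"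
    and mult_scaleC_right: "x * (c *\<^sub>C y) = c *\<^sub>C (x * y)"
    and norm_scaleC: "norm (c *\<^sub>C x) = cmod c * norm x"
    and star_star: "star (star x) = x"
    and star_add: "star (x + y) = star x + star y"
    and star_scaleC: "star (c *\<^sub>C x) = cnj c *\<^sub>C star x"
    and star_mult: "star (x * y) = star y * star x"
    and cstar_identity: "norm (star x * x) = (norm x)\<^sup>2"

lemma vector_space_scaleC: "vector_space (scaleC :: complex \<Rightarrow> 'a \<Rightarrow> 'a::cstar_algebra)"
proof
  fix x :: 'a
  show "1 *\<^sub>C x = x"
    using scaleC_of_real [of 1 x] by simp
qed (simp_all add: scaleC_add_right scaleC_add_left scaleC_scaleC)

instantiation complex :: cstar_algebra
begin
definition "scaleC_complex (c::complex) (x::complex) = c * x"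
definition "star_complex = cnj"
instance
  by standard
    (simp_all add: scaleC_complex_def star_complex_def algebra_simps norm_mult
      power2_eq_square scaleR_conv_of_real)
end

text \<open>The pair \<open>(c, a)\<close> stands for the element \<open>c + a\<close> of the unitization. The spectrum is
  always taken in the unitization; if the algebra already has a unit, this can only add the
  point \<open>0\<close>, so positivity is the usual notion in both cases.\<close>

definition unitization_mult ::
    "complex \<times> 'a \<Rightarrow> complex \<times> 'a \<Rightarrow> complex \<times> 'a::cstar_algebra" where
  "unitization_mult u v =
    (fst u * fst v, fst u *\<^sub>C snd v + fst v *\<^sub>C snd u + snd u * snd v)"

definition cstar_spectrum :: "'a::cstar_algebra \<Rightarrow> complex set" where
  "cstar_spectrum a =
    {c. \<nexists>v. unitization_mult (- c, a) v = (1, 0) \<and> unitization_mult v (- c, a) = (1, 0)}"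

definition cstar_nonneg :: "'a::cstar_algebra \<Rightarrow> bool" where
  "cstar_nonneg a \<longleftrightarrow> star a = a \<and> cstar_spectrum a \<subseteq> \<real>\<^sub>\<ge>\<^sub>0"

text \<open>Modules carry the usual compatible complex vector space structure. The carrier \<open>M\<close> is a
  complex subspace of the ambient type, so that spaces of functions can be treated as modules too.
  No axiom \<open>x \<cdot> 1 = x\<close> is imposed, as the algebra need not have a unit.\<close>

locale right_cstar_module = vector_space scaleX
  for scaleX :: "complex \<Rightarrow> 'x \<Rightarrow> 'x::ab_group_add" +
  fixes M :: "'x set" and act :: "'x \<Rightarrow> 'a::cstar_algebra \<Rightarrow> 'x"
  assumes subspace_carrier: "subspace M"
    and act_closed: "x \<in> M \<Longrightarrow> act x a \<in> M"
    and act_add_left: "x \<in> M \<Longrightarrow> y \<in> M \<Longrightarrow> act (x + y) a = act x a + act y a"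
    and act_add_right: "x \<in> M \<Longrightarrow> act x (a + b) = act x a + act x b"
    and act_mult: "x \<in> M \<Longrightarrow> act x (a * b) = act (act x a) b"
    and act_scale_left: "x \<in> M \<Longrightarrow> act (scaleX c x) a = scaleX c (act x a)"
    and act_scale_right: "x \<in> M \<Longrightarrow> act x (c *\<^sub>C a) = scaleX c (act x a)"

locale semi_inner_product_cstar_module = right_cstar_module scaleX M act
  for scaleX :: "complex \<Rightarrow> 'x \<Rightarrow> 'x::ab_group_add"
    and M :: "'x set" and act :: "'x \<Rightarrow> 'a::cstar_algebra \<Rightarrow> 'x" +
  fixes ip :: "'x \<Rightarrow> 'x \<Rightarrow> 'a"
  assumes ip_add_right: "x \<in> M \<Longrightarrow> y \<in> M \<Longrightarrow> z \<in> M \<Longrightarrow> ip x (y + z) = ip x y + ip x z"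
    and ip_act_right: "x \<in> M \<Longrightarrow> y \<in> M \<Longrightarrow> ip x (act y a) = ip x y * a"
    and star_ip: "x \<in> M \<Longrightarrow> y \<in> M \<Longrightarrow> star (ip x y) = ip y x"
    and ip_nonneg: "x \<in> M \<Longrightarrow> cstar_nonneg (ip x x)"

definition ip_seminorm :: "('x \<Rightarrow> 'x \<Rightarrow> 'a::cstar_algebra) \<Rightarrow> 'x \<Rightarrow> real" where
  "ip_seminorm ip x = sqrt (norm (ip x x))"

text \<open>The library's derivative requires a normed codomain, whereas the module is only seminormed.
  Derivatives of module-valued maps are complex linear.\<close>

definition has_module_derivative ::
    "(complex \<Rightarrow> 'x \<Rightarrow> 'x::ab_group_add) \<Rightarrow> ('x \<Rightarrow> 'x \<Rightarrow> 'a::cstar_algebra) \<Rightarrow>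
      ('a \<Rightarrow> 'x) \<Rightarrow> ('a \<Rightarrow> 'x) \<Rightarrow> 'a \<Rightarrow> bool" where
  "has_module_derivative scaleX ip f u q \<longleftrightarrow>
    Vector_Spaces.linear scaleC scaleX u \<and>
    (\<exists>K. \<forall>h. ip_seminorm ip (u h) \<le> K * norm h) \<and>
    ((\<lambda>h. ip_seminorm ip (f (q + h) - f q - u h) / norm h) \<longlongrightarrow> 0) (at 0)"

text \<open>As the seminorm may be degenerate, the derivative is unique only up to vectors of seminorm
  zero. By the Cauchy-Schwarz inequality such vectors do not affect inner products, so the choice
  made here is immaterial in \<open>derivative_ip\<close> below.\<close>

definition module_derivative ::
    "(complex \<Rightarrow> 'x \<Rightarrow> 'x::ab_group_add) \<Rightarrow> ('x \<Rightarrow> 'x \<Rightarrow> 'a::cstar_algebra) \<Rightarrow>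
      ('a \<Rightarrow> 'x) \<Rightarrow> 'a \<Rightarrow> 'a \<Rightarrow> 'x" where
  "module_derivative scaleX ip f q = (SOME u. has_module_derivative scaleX ip f u q)"

definition differentiable_near ::
    "(complex \<Rightarrow> 'x \<Rightarrow> 'x::ab_group_add) \<Rightarrow> ('x \<Rightarrow> 'x \<Rightarrow> 'a::cstar_algebra) \<Rightarrow> 'a \<Rightarrow> ('a \<Rightarrow> 'x) set"
  where
  "differentiable_near scaleX ip p =
    {f. (\<forall>q. ((\<lambda>t. ip_seminorm ip (f t - f q)) \<longlongrightarrow> 0) (at q)) \<and>
        (\<exists>U. open U \<and> p \<in> U \<and> (\<forall>q\<in>U. \<exists>u. has_module_derivative scaleX ip f u q))}"

definition ip1 :: "('x \<Rightarrow> 'x \<Rightarrow> 'a::cstar_algebra) \<Rightarrow> 'x \<Rightarrow> 'x \<Rightarrow> 'x \<Rightarrow> 'a" where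
  "ip1 ip e x y = ip x y - ip x e * ip e y"

text \<open>The last summand is the library's (real) Frechet derivative of a map from the algebra to
  itself; it cannot be complex linear in general, since \<open>ip1\<close> is conjugate linear on the left.\<close>

definition derivative_ip ::
    "(complex \<Rightarrow> 'x \<Rightarrow> 'x::ab_group_add) \<Rightarrow> ('x \<Rightarrow> 'x \<Rightarrow> 'a::cstar_algebra) \<Rightarrow>
      'x \<Rightarrow> 'a \<Rightarrow> 'a \<Rightarrow> ('a \<Rightarrow> 'x) \<Rightarrow> ('a \<Rightarrow> 'x) \<Rightarrow> 'a" where
  "derivative_ip scaleX ip e p a f g =
    ip1 ip e (module_derivative scaleX ip f p a) (module_derivative scaleX ip g p a) +
    ip1 ip e (f p) (g p) -
    frechet_derivative (\<lambda>t. ip1 ip e (f t) (g t)) (at p) a"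

end

theory Submission
  imports Defs
begin

text \<open>By the product rule, \<open>[f, g]\<^sub>a = \<langle>Df(p)(a) - f(p), Dg(p)(a) - g(p)\<rangle>\<^sub>1\<close>, so everything reduces to
  \<open>\<langle>\<cdot>, \<cdot>\<rangle>\<^sub>1\<close> being a semi-inner product. The analytic input is a Cauchy-Schwarz inequality, up to a
  constant factor: by polarization and scaling it follows from \<open>\<parallel>u\<parallel> \<le> \<parallel>u + v\<parallel>\<close> for positive \<open>u\<close> and
  \<open>v\<close>. That in turn holds because a self-adjoint element of the unitization has a spectral value of
  modulus equal to its norm.\<close>

subsection \<open>The unitization as a C*-algebra\<close>

text \<open>Positivity is stated as a condition on the spectrum, and a Cauchy-Schwarz estimate has
  to be extracted from it. It is used in one way only: through norms, in the unitization, where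
  adding a multiple of 1 shifts the spectrum. The new form is not shown positive by an order
  argument either; its diagonal values are again inner squares of the old form. That the norm of a
  self-adjoint element is attained on its spectrum is proved by repeated squaring. For g of norm 1
  the C*-identity keeps the norm of g^(2^k) equal to 1, whereas for r < 1 the powers (r g)^(2^k)
  tend to 0. If the spectrum missed the unit circle, the inverses of 1 - g^(2^k) and 1 - (r g)^(2^k)
  would nevertheless stay close for a suitable r. A vector of seminorm zero need not vanish:
  derivatives are determined only up to such null vectors, and e differs from e<e,e> by one. Inner
  products do not see them. Since the estimates serve only for boundedness, limits and null vectors,
  their constant factors do no harm.\<close>

interpretation scaleC: vector_space "scaleC :: complex \<Rightarrow> 'a \<Rightarrow> 'a::cstar_algebra"
  by (rule vector_space_scaleC)

instance cstar_algebra \<subseteq> banach ..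

lemma star_zero [simp]: "star (0::'a::cstar_algebra) = 0"
  using star_add[of "0::'a" 0] by simp

lemma star_minus [simp]: "star (- x) = - star (x::'a::cstar_algebra)"
  using star_add[of x "- x"] by (simp add: minus_unique)

lemma star_diff: "star (x - y) = star x - star (y::'a::cstar_algebra)"
  using star_add[of x "- y"] by simp

lemma norm_le_norm_star: "norm x \<le> norm (star (x::'a::cstar_algebra))"
proof (cases "x = 0")
  case False
  have "(norm x)\<^sup>2 \<le> norm (star x) * norm x"
    using norm_mult_ineq[of "star x" x] by (simp add: cstar_identity)
  then show ?thesis
    using False by (simp add: power2_eq_square)
qed simp

lemma norm_star [simp]: "norm (star x) = norm (x::'a::cstar_algebra)"
  using norm_le_norm_star[of x] norm_le_norm_star[of "star x"] by (simp add: star_star)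

lemma norm_mult_star: "norm (x * star x) = (norm (x::'a::cstar_algebra))\<^sup>2"
  using cstar_identity[of "star x"] by (simp add: star_star)

text \<open>Testing against \<open>star x\<close> suffices, by the C*-identity. In the absence of a
  unit this is how equations in the algebra are recovered from their multiples.\<close>

lemma mult_right_eq_0_imp: "x = 0" if "\<And>a. x * a = 0" for x :: "'a::cstar_algebra"
  using norm_mult_star[of x] that[of "star x"] by simp

lemma scaleR_scaleC: "(r *\<^sub>R c) *\<^sub>C x = r *\<^sub>R c *\<^sub>C x"
  for x :: "'a::cstar_algebra"
  by (simp add: scaleC_scaleC scaleR_conv_of_real flip: scaleC_of_real)

lemma scaleC_scaleR: "c *\<^sub>C r *\<^sub>R x = r *\<^sub>R c *\<^sub>C x" for x :: "'a::cstar_algebra"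
  by (simp add: scaleC_scaleC mult.commute flip: scaleC_of_real)

lemma bounded_linear_scaleC: "bounded_linear (scaleC c :: 'a::cstar_algebra \<Rightarrow> 'a)"
proof (rule bounded_linear_intro[where K = "cmod c"])
qed (simp_all add: scaleC_add_right norm_scaleC scaleC_scaleR)

text \<open>A fresh type, because pairs already carry the Euclidean norm as their class instance,
  and that is not a C*-norm here.\<close>

datatype 'a unitization = Unitization (scalar_part: complex) (algebra_part: 'a)

text \<open>Left multiplication by an element of the unitization on the original algebra, viewed as
  an ideal.\<close>

definition unitization_act :: "'a::cstar_algebra unitization \<Rightarrow> 'a \<Rightarrow> 'a" where
  "unitization_act z x = scalar_part z *\<^sub>C x + algebra_part z * x"

lemma bounded_linear_unitization_act [simp]: "bounded_linear (unitization_act z)"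
  unfolding unitization_act_def
  by (intro bounded_linear_add bounded_linear_scaleC bounded_linear_mult_right)

instantiation unitization :: (cstar_algebra) real_normed_algebra_1
begin

definition "0 = Unitization 0 0"
definition "1 = Unitization 1 0"
definition "z + w = Unitization (scalar_part z + scalar_part w) (algebra_part z + algebra_part w)"
definition "z - w = Unitization (scalar_part z - scalar_part w) (algebra_part z - algebra_part w)"
definition "- z = Unitization (- scalar_part z) (- algebra_part z)"
definition "z * w = Unitization (scalar_part z * scalar_part w)
  (scalar_part z *\<^sub>C algebra_part w + scalar_part w *\<^sub>C algebra_part z
    + algebra_part z * algebra_part w)"
definition "r *\<^sub>R z = Unitization (r *\<^sub>R scalar_part z) (r *\<^sub>R algebra_part z)"

text \<open>If the algebra is unital then its unitization does not act faithfully on it, so the operator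
  norm alone would be degenerate.\<close>

definition "norm z = max (cmod (scalar_part z)) (onorm (unitization_act z))"
definition "dist z w = norm (z - w :: 'a unitization)"
definition "sgn z = inverse (norm z) *\<^sub>R (z :: 'a unitization)"
definition "uniformity =
  (INF e\<in>{0<..}. principal {(x, y). dist x y < (e::real)} :: ('a unitization \<times> 'a unitization) filter)"
definition "open (U :: 'a unitization set) \<longleftrightarrow>
  (\<forall>x\<in>U. eventually (\<lambda>(x', y). x' = x \<longrightarrow> y \<in> U) uniformity)"

lemmas unitization_defs = zero_unitization_def plus_unitization_def minus_unitization_def
  uminus_unitization_def times_unitization_def scaleR_unitization_def
  one_unitization_def

lemma unitization_act_add: "unitization_act (z + w) = (\<lambda>x. unitization_act z x + unitization_act w x)"
  for z w :: "'a unitization"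
  by (rule ext) (simp add: unitization_act_def unitization_defs scaleC_add_left algebra_simps)

lemma unitization_act_mult: "unitization_act (z * w) = unitization_act z \<circ> unitization_act w"
  for z w :: "'a unitization"
  by (rule ext)
    (simp add: unitization_act_def unitization_defs scaleC_add_right scaleC_scaleC mult_scaleC_left
      mult_scaleC_right algebra_simps)

text \<open>The operator norm is attained in the direction of \<open>star x\<close>, since
  \<open>norm (x * star x)\<close> is the square of \<open>norm x\<close>.\<close>

lemma onorm_unitization_act_Unitization_0:
  "onorm (unitization_act (Unitization 0 x)) = norm (x::'a)"
proof (rule antisym)
  have act: "unitization_act (Unitization 0 x) y = x * y" for y
    by (simp add: unitization_act_def)
  show "onorm (unitization_act (Unitization 0 x)) \<le> norm x"
    by (rule onorm_bound) (simp_all add: act norm_mult_ineq)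
  have "(norm x)\<^sup>2 \<le> onorm (unitization_act (Unitization 0 x)) * norm x"
    using onorm[of "unitization_act (Unitization 0 x)" "star x"]
    by (simp add: act norm_mult_star)
  then show "norm x \<le> onorm (unitization_act (Unitization 0 x))"
    by (cases "x = 0") (simp_all add: power2_eq_square onorm_pos_le)
qed

lemma norm_Unitization_0: "norm (Unitization 0 x) = norm (x::'a)"
  by (simp add: norm_unitization_def onorm_unitization_act_Unitization_0)

lemma norm_scalar_part_le: "cmod (scalar_part z) \<le> norm (z::'a unitization)"
  by (simp add: norm_unitization_def)

lemma norm_unitization_act_le: "norm (unitization_act z x) \<le> norm z * norm (x::'a)"
  using onorm[of "unitization_act z" x]
  by (rule order_trans) (auto simp: norm_unitization_def intro: mult_right_mono)

lemma norm_unitization_le: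
  "norm z \<le> b" if "cmod (scalar_part z) \<le> b" "\<And>x. norm (unitization_act z x) \<le> b * norm x"
  for z :: "'a unitization"
proof -
  have "0 \<le> b"
    using that(1) norm_ge_zero order_trans by blast
  then show ?thesis
    unfolding norm_unitization_def using that by (auto intro: onorm_bound)
qed

lemma norm_unitization_triangle: "norm (z + w) \<le> norm z + norm (w::'a unitization)"
proof (rule norm_unitization_le)
  show "cmod (scalar_part (z + w)) \<le> norm z + norm w"
    using norm_triangle_ineq[of "scalar_part z" "scalar_part w"] norm_scalar_part_le[of z]
      norm_scalar_part_le[of w] by (simp add: unitization_defs)
  show "norm (unitization_act (z + w) x) \<le> (norm z + norm w) * norm x" for x
    unfolding unitization_act_add distrib_right
    by (intro norm_triangle_mono norm_unitization_act_le)
qed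

lemma norm_unitization_mult: "norm (z * w) \<le> norm z * norm (w::'a unitization)"
proof (rule norm_unitization_le)
  have nonneg: "0 \<le> norm z"
    using norm_scalar_part_le[of z] norm_ge_zero order_trans by blast
  then show "cmod (scalar_part (z * w)) \<le> norm z * norm w"
    by (simp add: unitization_defs norm_mult mult_mono norm_scalar_part_le)
  show "norm (unitization_act (z * w) x) \<le> norm z * norm w * norm x" for x
    using norm_unitization_act_le[of z "unitization_act w x"]
      mult_left_mono[OF norm_unitization_act_le[of w x] nonneg]
    by (simp add: unitization_act_mult algebra_simps)
qed

lemma norm_unitization_scaleR: "norm (r *\<^sub>R z) = \<bar>r\<bar> * norm (z::'a unitization)"
proof -
  have "unitization_act (r *\<^sub>R z) = (\<lambda>x. r *\<^sub>R unitization_act z x)"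
    by (intro ext)
      (simp add: unitization_act_def unitization_defs scaleR_add_right scaleR_scaleC)
  then show ?thesis
    by (simp add: norm_unitization_def onorm_scaleR unitization_defs norm_mult
        max_mult_distrib_left)
qed

text \<open>The first term of the maximum kills the scalar part; on the remaining ideal the norm is
  the original one.\<close>

lemma norm_unitization_eq_0: "norm z = 0 \<longleftrightarrow> z = (0::'a unitization)"
proof
  assume *: "norm z = 0"
  then have "scalar_part z = 0"
    using norm_scalar_part_le[of z] by simp
  then have "z = Unitization 0 (algebra_part z)"
    by (metis unitization.collapse)
  then show "z = 0"
    using * norm_Unitization_0[of "algebra_part z"] by (simp add: zero_unitization_def)
qed (simp add: zero_unitization_def norm_Unitization_0)

instance
proof
  show "norm (1::'a unitization) = 1"
  proof (rule antisym)
    show "norm (1::'a unitization) \<le> 1"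
      by (rule norm_unitization_le) (simp_all add: unitization_defs unitization_act_def)
    show "1 \<le> norm (1::'a unitization)"
      using norm_scalar_part_le[of "1::'a unitization"] by (simp add: one_unitization_def)
  qed
qed (simp_all add: norm_unitization_triangle norm_unitization_mult norm_unitization_scaleR
    norm_unitization_eq_0 dist_unitization_def sgn_unitization_def uniformity_unitization_def
    open_unitization_def,
    simp_all add: unitization_defs scaleC_add_left scaleC_add_right scaleC_scaleC scaleC_scaleR
    mult_scaleC_left mult_scaleC_right scaleR_add_left scaleR_add_right scaleR_scaleC algebra_simps)

end

instantiation unitization :: (cstar_algebra) cstar_algebra
begin

definition "c *\<^sub>C z = Unitization (c * scalar_part z) (c *\<^sub>C algebra_part z)"
definition "star z = Unitization (cnj (scalar_part z)) (star (algebra_part z))"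

lemmas unitization_star_defs = unitization_defs scaleC_unitization_def star_unitization_def

lemma unitization_act_scaleC: "unitization_act (c *\<^sub>C z) = (\<lambda>x. c *\<^sub>C unitization_act z x)"
  for z :: "'a unitization"
  by (rule ext)
    (simp add: unitization_act_def unitization_star_defs scaleC_add_right scaleC_scaleC mult_scaleC_left)

lemma star_unitization_act_mult:
  "star (unitization_act z x) * unitization_act z x = star x * unitization_act (star z * z) x"
  for z :: "'a unitization"
  by (simp add: unitization_act_def unitization_star_defs star_add star_mult star_scaleC
      scaleC_add_right scaleC_scaleC mult_scaleC_left mult_scaleC_right algebra_simps)

lemma norm_unitization_scaleC: "norm (c *\<^sub>C z) = cmod c * norm (z::'a unitization)"
proof (rule antisym)
  have le: "norm (d *\<^sub>C w) \<le> cmod d * norm w" for d and w :: "'a unitization"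
  proof (rule norm_unitization_le)
    show "cmod (scalar_part (d *\<^sub>C w)) \<le> cmod d * norm w"
      by (simp add: unitization_star_defs norm_mult mult_left_mono norm_scalar_part_le)
    show "norm (unitization_act (d *\<^sub>C w) x) \<le> cmod d * norm w * norm x" for x
      using mult_left_mono[OF norm_unitization_act_le[of w x], of "cmod d"]
      by (simp add: unitization_act_scaleC norm_scaleC mult.assoc)
  qed
  show "norm (c *\<^sub>C z) \<le> cmod c * norm z"
    by (rule le)
  have "norm z \<le> inverse (cmod c) * norm (c *\<^sub>C z)" if "c \<noteq> 0"
  proof -
    have "inverse c *\<^sub>C c *\<^sub>C z = z"
      using that by (simp add: unitization_star_defs flip: mult.assoc)
    then show ?thesis
      using le[of "inverse c" "c *\<^sub>C z"] by (simp add: norm_inverse)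
  qed
  then have "cmod c * norm z \<le> norm (c *\<^sub>C z)" if "c \<noteq> 0"
    using that by (simp add: field_simps)
  moreover have "0 \<le> norm (c *\<^sub>C z)"
    using norm_scalar_part_le[of "c *\<^sub>C z"] norm_ge_zero order_trans by blast
  ultimately show "cmod c * norm z \<le> norm (c *\<^sub>C z)"
    by (cases "c = 0") auto
qed

text \<open>Both terms of the maximum are compatible with the C*-identity: the scalar part is a star
  homomorphism to the complex numbers, and for the operator term the square of the norm of z x is
  the norm of x* (z* z) x. This gives one inequality; it also makes \<open>star\<close> isometric,
  which gives the other.\<close>

lemma norm_unitization_cstar: "norm (star z * z) = (norm (z::'a unitization))\<^sup>2"
proof -
  have nonneg: "0 \<le> norm (w::'a unitization)" for w
    using norm_scalar_part_le[of w] norm_ge_zero order_trans by blast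
  have le: "(norm w)\<^sup>2 \<le> norm (star w * w)" for w :: "'a unitization"
  proof -
    have "norm w \<le> sqrt (norm (star w * w))"
    proof (rule norm_unitization_le)
      have "(cmod (scalar_part w))\<^sup>2 = cmod (scalar_part (star w * w))"
        by (simp add: unitization_star_defs norm_mult power2_eq_square)
      then show "cmod (scalar_part w) \<le> sqrt (norm (star w * w))"
        using norm_scalar_part_le[of "star w * w"] by (intro real_le_rsqrt) simp
      fix x
      have "(norm (unitization_act w x))\<^sup>2 = norm (star x * unitization_act (star w * w) x)"
        by (simp add: star_unitization_act_mult flip: cstar_identity)
      also have "\<dots> \<le> norm (star x) * (norm (star w * w) * norm x)"
        by (rule order_trans[OF norm_mult_ineq])
          (intro mult_left_mono norm_unitization_act_le, simp)
      finally have "(norm (unitization_act w x))\<^sup>2 \<le> norm (star w * w) * (norm x)\<^sup>2"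
        by (simp add: power2_eq_square algebra_simps)
      then show "norm (unitization_act w x) \<le> sqrt (norm (star w * w)) * norm x"
        by (metis real_le_rsqrt real_sqrt_mult real_sqrt_abs abs_norm_cancel)
    qed
    then show ?thesis
      using nonneg sqrt_ge_absD power_mono[of "norm w" "sqrt (norm (star w * w))" 2] by simp
  qed
  have le_star: "norm w \<le> norm (star w)" for w :: "'a unitization"
  proof (cases "norm w = 0")
    case False
    have "(norm w)\<^sup>2 \<le> norm (star w) * norm w"
      using le norm_unitization_mult order_trans by blast
    then show ?thesis
      using False nonneg[of w] by (simp add: power2_eq_square)
  qed (simp add: nonneg)
  have "norm (star z) \<le> norm z"
    using le_star[of "star z"] by (simp add: unitization_star_defs star_star)
  then have "norm (star z * z) \<le> (norm z)\<^sup>2"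
    using norm_unitization_mult[of "star z" z] mult_right_mono[OF _ nonneg[of z]]
    by (fastforce simp: power2_eq_square)
  then show ?thesis
    using le[of z] by simp
qed

instance
proof
  fix X :: "nat \<Rightarrow> 'a unitization"
  assume X: "Cauchy X"
  let ?c = "\<lambda>n. scalar_part (X n)" and ?a = "\<lambda>n. algebra_part (X n)"
  have norm_le: "norm z \<le> cmod (scalar_part z) + norm (algebra_part z)" for z :: "'a unitization"
    using norm_triangle_ineq[of "scalar_part z *\<^sub>C 1" "Unitization 0 (algebra_part z)"]
    by (simp add: norm_unitization_scaleC norm_Unitization_0)
      (simp add: unitization_star_defs)
  have scalar: "bounded_linear (scalar_part :: 'a unitization \<Rightarrow> complex)"
    by (rule bounded_linear_intro[where K = 1])
      (simp_all add: unitization_defs norm_scalar_part_le)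
  \<comment> \<open>The constant 2 comes from writing the algebra part as z minus its scalar part
    times 1, both of norm at most \<open>norm z\<close>.\<close>
  have algebra: "bounded_linear (algebra_part :: 'a unitization \<Rightarrow> 'a)"
  proof (rule bounded_linear_intro[where K = 2])
    fix z :: "'a unitization"
    have "norm (algebra_part z) = norm (z - scalar_part z *\<^sub>C 1)"
      by (simp add: unitization_star_defs norm_Unitization_0 flip: norm_Unitization_0)
    also have "\<dots> \<le> norm z + norm (scalar_part z *\<^sub>C (1::'a unitization))"
      by (rule norm_triangle_ineq4)
    finally show "norm (algebra_part z) \<le> norm z * 2"
      using norm_scalar_part_le[of z] by (simp add: norm_unitization_scaleC)
  qed (simp_all add: unitization_defs)
  obtain c a where c: "?c \<longlonglongrightarrow> c" and a: "?a \<longlonglongrightarrow> a"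
    using bounded_linear.Cauchy[OF scalar X] bounded_linear.Cauchy[OF algebra X]
    by (auto simp: Cauchy_convergent_iff convergent_def)
  have "(\<lambda>n. cmod (?c n - c) + norm (?a n - a)) \<longlonglongrightarrow> 0"
    using tendsto_add[OF tendsto_norm_zero[OF LIM_zero[OF c]] tendsto_norm_zero[OF LIM_zero[OF a]]]
    by simp
  then have "(\<lambda>n. X n - Unitization c a) \<longlonglongrightarrow> 0"
    by (rule Lim_null_comparison[rotated])
      (intro always_eventually allI order_trans[OF norm_le], simp add: unitization_defs)
  then show "convergent X"
    using LIM_zero_cancel convergentI by blast
qed (simp_all add: norm_unitization_scaleC norm_unitization_cstar,
    simp_all add: unitization_star_defs scaleC_add_left scaleC_add_right scaleC_scaleC
    mult_scaleC_left mult_scaleC_right star_star star_add star_scaleC star_mult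
    scaleR_conv_of_real scaleC_of_real algebra_simps)

end

subsection \<open>Spectra of self-adjoint elements\<close>

definition two_sided_inverse :: "'a::monoid_mult \<Rightarrow> 'a \<Rightarrow> bool" where
  "two_sided_inverse x y \<longleftrightarrow> x * y = 1 \<and> y * x = 1"

lemma two_sided_inverse_unique:
  assumes "two_sided_inverse x y" "two_sided_inverse x z"
  shows "y = z"
  using assms unfolding two_sided_inverse_def by (metis mult.assoc mult_1_left mult_1_right)

text \<open>The resolvent identity, from which all estimates between inverses below are
  derived.\<close>

lemma two_sided_inverse_diff:
  fixes x y :: "'a::ring_1"
  assumes "two_sided_inverse x u" "two_sided_inverse y v"
  shows "u - v = u * (y - x) * v"
proof -
  have "u * (y - x) * v = u * (y * v) - (u * x) * v"
    by (simp add: algebra_simps)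
  then show ?thesis
    using assms by (simp add: two_sided_inverse_def)
qed

text \<open>The estimate is read off the fixed-point equation for \<open>y - 1\<close>, obtained
  from the geometric series.\<close>

lemma neumann_series:
  fixes x :: "'a::{real_normed_algebra_1, banach}"
  assumes "norm x < 1"
  obtains y where "two_sided_inverse (1 - x) y" "norm (y - 1) \<le> norm x / (1 - norm x)"
proof
  define y where "y = (\<Sum>n. x ^ n)"
  have "summable (\<lambda>n. norm x ^ n)"
    using assms by (simp add: summable_geometric)
  then have summable: "summable (\<lambda>n. x ^ n)"
    by (rule summable_comparison_test[rotated]) (auto intro: norm_power_ineq)
  have y_eq: "y = 1 + (\<Sum>n. x ^ Suc n)"
    unfolding y_def by (subst suminf_split_head[OF summable]) simp
  then have left: "y = 1 + x * y"
    by (simp add: y_def suminf_mult[OF summable])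
  have right: "y = 1 + y * x"
    using y_eq unfolding power_Suc2 suminf_mult2[OF summable, symmetric] y_def[symmetric] .
  show "two_sided_inverse (1 - x) y"
    using left right by (simp add: two_sided_inverse_def algebra_simps)
  have diff: "y - 1 = x + x * (y - 1)"
    using left by (simp add: algebra_simps)
  have "norm (y - 1) \<le> norm x + norm x * norm (y - 1)"
    by (subst diff) (rule norm_triangle_mono[OF order_refl norm_mult_ineq])
  then show "norm (y - 1) \<le> norm x / (1 - norm x)"
    using assms by (simp add: field_simps)
qed

section \<open>Inverses on the unit circle for self-adjoint elements\<close>

lemma star_one [simp]: "star 1 = (1 :: 'a::{cstar_algebra, real_normed_algebra_1})"
  by (metis mult_1_left mult_1_right star_mult star_star)

lemma star_power: "star (x ^ n) = star x ^ n" for x :: "'a::{cstar_algebra, real_normed_algebra_1}"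
  by (induction n) (simp_all add: star_mult power_commutes)

text \<open>Each power of \<open>h\<close> is self-adjoint, so its square has the form
  \<open>star x * x\<close> and the C*-identity squares the norm.\<close>

lemma norm_power_two_power:
  fixes h :: "'a::{cstar_algebra, real_normed_algebra_1}"
  assumes "star h = h"
  shows "norm (h ^ 2 ^ k) = norm h ^ 2 ^ k"
proof (induction k)
  case (Suc k)
  have "h ^ 2 ^ Suc k = star (h ^ 2 ^ k) * h ^ 2 ^ k"
    by (simp add: star_power assms mult_2 power_add)
  then show ?case
    using Suc by (simp add: cstar_identity mult.commute flip: power_mult)
qed simp

text \<open>In particular the spectra of \<open>g\<close> and \<open>h\<close> miss the unit circle.
  All \<open>\<zeta>\<close> on the circle are taken at once because the squaring step at
  \<open>\<zeta>\<close> needs both square roots of \<open>\<zeta>\<close>.\<close>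

definition inverses_near :: "real \<Rightarrow> 'a::{cstar_algebra, real_normed_algebra_1} \<Rightarrow> 'a \<Rightarrow> bool" where
  "inverses_near \<epsilon> g h \<longleftrightarrow> (\<forall>\<zeta>. cmod \<zeta> = 1 \<longrightarrow> (\<exists>u v. two_sided_inverse (1 - \<zeta> *\<^sub>C g) u \<and>
    two_sided_inverse (1 - \<zeta> *\<^sub>C h) v \<and> norm (u - v) \<le> \<epsilon>))"

lemma two_sided_inverse_square:
  fixes g :: "'a::{cstar_algebra, real_normed_algebra_1}"
  assumes u: "two_sided_inverse (1 - \<zeta> *\<^sub>C g) u" and v: "two_sided_inverse (1 - (- \<zeta>) *\<^sub>C g) v"
  shows "two_sided_inverse (1 - \<zeta>\<^sup>2 *\<^sub>C g\<^sup>2) ((1 / 2) *\<^sub>R (u + v))"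
proof -
  let ?p = "1 - \<zeta> *\<^sub>C g" and ?q = "1 - (- \<zeta>) *\<^sub>C g"
  have pq: "1 - \<zeta>\<^sup>2 *\<^sub>C g\<^sup>2 = ?p * ?q" "1 - \<zeta>\<^sup>2 *\<^sub>C g\<^sup>2 = ?q * ?p" and sum: "?q + ?p = 2"
    by (simp_all add: algebra_simps mult_scaleC_left mult_scaleC_right scaleC_scaleC
        power2_eq_square)
  \<comment> \<open>The factors commute, so in each term the one to be cancelled can be moved next
    to its inverse. What remains is \<open>?q + ?p = 2\<close>, compensated by the factor
    1/2.\<close>
  have "(1 - \<zeta>\<^sup>2 *\<^sub>C g\<^sup>2) * (u + v) = ?q * (?p * u) + ?p * (?q * v)"
    unfolding distrib_left by (subst (1) pq(2), subst (1) pq(1)) (simp only: mult.assoc)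
  moreover have "(u + v) * (1 - \<zeta>\<^sup>2 *\<^sub>C g\<^sup>2) = (u * ?p) * ?q + (v * ?q) * ?p"
    unfolding distrib_right by (subst (1) pq(1), subst (1) pq(2)) (simp only: mult.assoc)
  moreover have "(1 / 2) *\<^sub>R (2 :: 'a) = 1"
    by (metis scaleR_half_double one_add_one)
  ultimately show ?thesis
    using u v sum by (simp add: two_sided_inverse_def)
qed

text \<open>Since \<open>1 - \<zeta>\<^sup>2 g\<^sup>2 = (1 - \<zeta> g) (1 + \<zeta> g)\<close>, the inverse at \<open>g\<^sup>2\<close> is the mean of two inverses
  at \<open>g\<close>, so squaring does not increase the distance.\<close>

lemma inverses_near_square:
  assumes "inverses_near \<epsilon> g h"
  shows "inverses_near \<epsilon> (g\<^sup>2) (h\<^sup>2)"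
  unfolding inverses_near_def
proof (intro allI impI)
  fix \<zeta> :: complex
  assume \<zeta>: "cmod \<zeta> = 1"
  define \<eta> where "\<eta> = csqrt \<zeta>"
  have \<eta>: "cmod \<eta> = 1" "cmod (- \<eta>) = 1" "\<zeta> = \<eta>\<^sup>2"
    using \<zeta> by (simp_all add: \<eta>_def norm_csqrt)
  obtain u v where uv: "two_sided_inverse (1 - \<eta> *\<^sub>C g) u" "two_sided_inverse (1 - \<eta> *\<^sub>C h) v"
    "norm (u - v) \<le> \<epsilon>"
    using assms \<eta>(1) unfolding inverses_near_def by blast
  obtain u' v' where uv': "two_sided_inverse (1 - (- \<eta>) *\<^sub>C g) u'"
    "two_sided_inverse (1 - (- \<eta>) *\<^sub>C h) v'" "norm (u' - v') \<le> \<epsilon>"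
    using assms \<eta>(2) unfolding inverses_near_def by blast
  have "(1 / 2) *\<^sub>R (u + u') - (1 / 2) *\<^sub>R (v + v') = (1 / 2) *\<^sub>R ((u - v) + (u' - v'))"
    by (simp add: algebra_simps)
  then have "norm ((1 / 2) *\<^sub>R (u + u') - (1 / 2) *\<^sub>R (v + v')) \<le> \<epsilon>"
    using norm_triangle_ineq[of "u - v" "u' - v'"] uv(3) uv'(3)
    by (simp only: norm_scaleR)
  then show "\<exists>u v. two_sided_inverse (1 - \<zeta> *\<^sub>C g\<^sup>2) u \<and> two_sided_inverse (1 - \<zeta> *\<^sub>C h\<^sup>2) v \<and>
      norm (u - v) \<le> \<epsilon>"
    using two_sided_inverse_square[OF uv(1) uv'(1)] two_sided_inverse_square[OF uv(2) uv'(2)] \<eta>(3)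
    by blast
qed

lemma inverses_near_power:
  assumes "inverses_near \<epsilon> g h"
  shows "inverses_near \<epsilon> (g ^ 2 ^ k) (h ^ 2 ^ k)"
proof (induction k)
  case (Suc k)
  then show ?case
    using inverses_near_square[of \<epsilon> "g ^ 2 ^ k" "h ^ 2 ^ k"] by (simp add: mult.commute flip: power_mult)
qed (simp add: assms)

text \<open>By the resolvent identity the norm of the inverse at most doubles on a small ball around
  each point of the circle; finitely many such balls cover the circle by compactness.\<close>

lemma inverses_bounded_on_circle:
  fixes g :: "'a::{cstar_algebra, real_normed_algebra_1}"
  assumes inv: "\<And>\<zeta>. cmod \<zeta> = 1 \<Longrightarrow> two_sided_inverse (1 - \<zeta> *\<^sub>C g) (R \<zeta>)"
  obtains M where "\<And>\<zeta>. cmod \<zeta> = 1 \<Longrightarrow> norm (R \<zeta>) \<le> M"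
proof -
  \<comment> \<open>The radius makes the factor in the resolvent identity at most 1/2, so that the
    term with \<open>R \<eta>\<close> can be absorbed on the left; the summand 1 keeps the
    denominator positive.\<close>
  define \<delta> where "\<delta> \<zeta> = inverse (2 * (norm (R \<zeta>) * norm g + 1))" for \<zeta>
  have \<delta>_pos: "0 < \<delta> \<zeta>" for \<zeta>
    by (simp add: \<delta>_def add_nonneg_pos)
  have local_bound: "norm (R \<eta>) \<le> 2 * norm (R \<zeta>)"
    if \<zeta>: "cmod \<zeta> = 1" and \<eta>: "cmod \<eta> = 1" and near: "\<eta> \<in> ball \<zeta> (\<delta> \<zeta>)" for \<zeta> \<eta>
  proof -
    have "R \<eta> - R \<zeta> = - (R \<zeta> * ((\<zeta> - \<eta>) *\<^sub>C g) * R \<eta>)"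
      using two_sided_inverse_diff[OF inv[OF \<zeta>] inv[OF \<eta>]]
      by (simp add: scaleC.scale_left_diff_distrib algebra_simps)
    also have "norm \<dots> \<le> norm (R \<zeta>) * norm ((\<zeta> - \<eta>) *\<^sub>C g) * norm (R \<eta>)"
      unfolding norm_minus_cancel
      by (rule order_trans[OF norm_mult_ineq]) (intro mult_right_mono norm_mult_ineq norm_ge_zero)
    also have "\<dots> = (cmod (\<zeta> - \<eta>) * (norm (R \<zeta>) * norm g)) * norm (R \<eta>)"
      by (simp add: norm_scaleC)
    also have "\<dots> \<le> 1 / 2 * norm (R \<eta>)"
    proof (rule mult_right_mono)
      have "cmod (\<zeta> - \<eta>) * (norm (R \<zeta>) * norm g) \<le> \<delta> \<zeta> * (norm (R \<zeta>) * norm g + 1)"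
        using near \<delta>_pos[of \<zeta>] by (intro mult_mono) (auto simp: dist_norm)
      also have "\<dots> = 1 / 2"
        using add_nonneg_pos[of "norm (R \<zeta>) * norm g" 1] by (simp add: \<delta>_def field_simps)
      finally show "cmod (\<zeta> - \<eta>) * (norm (R \<zeta>) * norm g) \<le> 1 / 2" .
    qed simp
    finally show ?thesis
      using norm_triangle_ineq2[of "R \<eta>" "R \<zeta>"] by simp
  qed
  obtain C where C: "C \<subseteq> sphere 0 1" "finite C" "sphere (0::complex) 1 \<subseteq> (\<Union>\<zeta>\<in>C. ball \<zeta> (\<delta> \<zeta>))"
    using \<delta>_pos by (rule_tac compactE_image[of "sphere (0::complex) 1" "sphere 0 1" "\<lambda>\<zeta>. ball \<zeta> (\<delta> \<zeta>)"]) auto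
  show thesis
  proof (rule that)
    fix \<eta> :: complex
    assume \<eta>: "cmod \<eta> = 1"
    then obtain \<zeta> where \<zeta>: "\<zeta> \<in> C" "\<eta> \<in> ball \<zeta> (\<delta> \<zeta>)"
      using C(3) by force
    then have "norm (R \<eta>) \<le> 2 * norm (R \<zeta>)"
      using C(1) \<eta> by (intro local_bound) auto
    also have "\<dots> \<le> (\<Sum>\<zeta>\<in>C. 2 * norm (R \<zeta>))"
      using C(2) \<zeta>(1) by (intro member_le_sum) auto
    finally show "norm (R \<eta>) \<le> (\<Sum>\<zeta>\<in>C. 2 * norm (R \<zeta>))" .
  qed
qed

text \<open>Otherwise the inverses are bounded on the circle, and those for
  \<open>r *\<^sub>R g\<close> lie within 1/4 of them for some r < 1. Squaring preserves this
  distance, but finally the power of \<open>r *\<^sub>R g\<close> is so small that its inverse is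
  almost 1, while the power of \<open>g\<close> still has norm 1.\<close>

lemma not_all_invertible_on_circle:
  fixes g :: "'a::{cstar_algebra, real_normed_algebra_1}"
  assumes "star g = g" "norm g = 1"
  shows "\<exists>\<zeta>. cmod \<zeta> = 1 \<and> (\<nexists>u. two_sided_inverse (1 - \<zeta> *\<^sub>C g) u)"
proof (rule ccontr)
  assume "\<not> ?thesis"
  then obtain R where R: "\<And>\<zeta>. cmod \<zeta> = 1 \<Longrightarrow> two_sided_inverse (1 - \<zeta> *\<^sub>C g) (R \<zeta>)"
    by metis
  then obtain M0 where M0: "\<And>\<zeta>. cmod \<zeta> = 1 \<Longrightarrow> norm (R \<zeta>) \<le> M0"
    using inverses_bounded_on_circle[OF R] by blast
  define M where "M = max 1 M0"
  have M: "1 \<le> M" "\<And>\<zeta>. cmod \<zeta> = 1 \<Longrightarrow> norm (R \<zeta>) \<le> M"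
    using M0 by (auto simp: M_def max.coboundedI2)
  \<comment> \<open>Two demands fix the size: \<open>d * M \<le> 1 / 2\<close> gives
    \<open>norm v \<le> 2 * M\<close> by absorption, and then the distance is at most
    \<open>2 * M * (d * M) = 1 / 4\<close>. The bound 1 below \<open>M\<close> ensures the first
    demand and \<open>d < 1\<close>.\<close>
  define d where "d = 1 / (8 * M\<^sup>2)"
  have "M \<le> M\<^sup>2" "1 \<le> M\<^sup>2"
    using M(1) self_le_power[of M 2] one_le_power[of M 2] by simp_all
  then have d: "0 < d" "d < 1" "d * M \<le> 1 / 2" "d * (2 * M\<^sup>2) = 1 / 4"
    using M(1) by (auto simp: d_def field_simps)
  define r where "r = 1 - d"
  have "inverses_near (1 / 4) g (r *\<^sub>R g)"
    unfolding inverses_near_def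
  proof (intro allI impI)
    fix \<zeta> :: complex
    assume \<zeta>: "cmod \<zeta> = 1"
    have "norm (\<zeta> *\<^sub>C r *\<^sub>R g) < 1"
      using d \<zeta> by (simp add: norm_scaleC assms r_def)
    then obtain v where v: "two_sided_inverse (1 - \<zeta> *\<^sub>C r *\<^sub>R g) v"
      by (rule neumann_series)
    have "v - R \<zeta> = - (v * (d *\<^sub>R \<zeta> *\<^sub>C g) * R \<zeta>)"
      using two_sided_inverse_diff[OF v R[OF \<zeta>]]
      by (simp add: r_def scaleC_scaleR algebra_simps)
    also have "norm \<dots> \<le> norm v * d * norm (R \<zeta>)"
      using norm_mult_ineq[of "v * (d *\<^sub>R \<zeta> *\<^sub>C g)" "R \<zeta>"] norm_mult_ineq[of v "d *\<^sub>R \<zeta> *\<^sub>C g"] d(1)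
      by (fastforce simp: norm_scaleC \<zeta> assms intro: order_trans mult_right_mono)
    also have "\<dots> \<le> norm v * d * M"
      using M(2)[OF \<zeta>] d(1) by (intro mult_left_mono) simp_all
    finally have diff: "norm (v - R \<zeta>) \<le> norm v * (d * M)"
      by (simp add: mult.assoc)
    also have "\<dots> \<le> norm v * (1 / 2)"
      by (intro mult_left_mono d norm_ge_zero)
    finally have "norm v \<le> 2 * M"
      using M(2)[OF \<zeta>] norm_triangle_ineq2[of v "R \<zeta>"] by simp
    then have "norm v * (d * M) \<le> 2 * M * (d * M)"
      using d(1) M(1) by (intro mult_right_mono) simp_all
    also have "\<dots> = 1 / 4"
      using d(4) by (simp add: power2_eq_square algebra_simps)
    finally have "norm (R \<zeta> - v) \<le> 1 / 4"
      using diff by (simp add: norm_minus_commute)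
    then show "\<exists>u v. two_sided_inverse (1 - \<zeta> *\<^sub>C g) u \<and> two_sided_inverse (1 - \<zeta> *\<^sub>C r *\<^sub>R g) v \<and>
        norm (u - v) \<le> 1 / 4"
      using R[OF \<zeta>] v by blast
  qed
  then have near: "inverses_near (1 / 4) (g ^ 2 ^ k) ((r *\<^sub>R g) ^ 2 ^ k)" for k
    by (rule inverses_near_power)
  \<comment> \<open>A norm below 1/13 puts the Neumann inverse within 1/12 of 1. Together with the
    distance 1/4 this gives 1/3, and \<open>norm (1 - G) \<le> 2\<close> then forces
    \<open>norm G\<close> down to 2/3.\<close>
  obtain k where "r ^ k < 1 / 13"
    using real_arch_pow_inv[of "1 / 13" r] d(1) by (auto simp: r_def)
  moreover have "r ^ 2 ^ k \<le> r ^ k"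
    using d by (intro power_decreasing) (auto simp: r_def less_imp_le)
  ultimately have small: "r ^ 2 ^ k < 1 / 13"
    by simp
  define G where "G = g ^ 2 ^ k"
  define H where "H = (r *\<^sub>R g) ^ 2 ^ k"
  have G: "norm G = 1"
    by (simp add: G_def norm_power_two_power assms)
  have "norm H = r ^ 2 ^ k"
    using d G by (simp add: H_def scaleR_power G_def r_def power_abs)
  then have H: "norm H < 1 / 13"
    using small by simp
  obtain u v where u: "two_sided_inverse (1 - G) u" and v: "two_sided_inverse (1 - H) v"
    and uv: "norm (u - v) \<le> 1 / 4"
    using near[of k] unfolding inverses_near_def G_def H_def by (metis norm_one scaleC.scale_one)
  obtain w where w: "two_sided_inverse (1 - H) w" "norm (w - 1) \<le> norm H / (1 - norm H)"
    using neumann_series[of H] H by auto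
  have "norm (v - 1) \<le> norm H / (1 - norm H)"
    using w two_sided_inverse_unique[OF v w(1)] by simp
  also have "\<dots> \<le> 1 / 12"
    using H by (simp add: field_simps)
  finally have "norm (u - 1) \<le> 1 / 3"
    using uv norm_triangle_ineq[of "u - v" "v - 1"] by simp
  moreover have "G = (1 - G) * (u - 1)"
    using u by (simp add: two_sided_inverse_def algebra_simps)
  then have "norm G \<le> norm (1 - G) * norm (u - 1)"
    by (metis norm_mult_ineq)
  moreover have "norm (1 - G) \<le> 2"
    using norm_triangle_ineq4[of 1 G] G by simp
  ultimately have "norm G \<le> 2 * (1 / 3)"
    by (meson mult_mono norm_ge_zero order_trans zero_le_numeral)
  then show False
    using G by simp
qed

section \<open>Spectrum, norm and positivity\<close>

definition unital_spectrum :: "'a::{cstar_algebra, real_normed_algebra_1} \<Rightarrow> complex set" where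
  "unital_spectrum x = {c. \<nexists>y. two_sided_inverse (x - c *\<^sub>C 1) y}"

lemma two_sided_inverse_scaleC:
  fixes x :: "'a::{cstar_algebra, real_normed_algebra_1}"
  assumes "c \<noteq> 0" "two_sided_inverse x y"
  shows "two_sided_inverse (c *\<^sub>C x) (inverse c *\<^sub>C y)"
  using assms by (simp add: two_sided_inverse_def mult_scaleC_left mult_scaleC_right scaleC_scaleC)

lemma unital_spectrum_uminus: "c \<in> unital_spectrum (- x) \<longleftrightarrow> - c \<in> unital_spectrum x"
  for x :: "'a::{cstar_algebra, real_normed_algebra_1}"
proof -
  have "(\<exists>y. two_sided_inverse (- z) y) \<longleftrightarrow> (\<exists>y. two_sided_inverse z y)" for z :: 'a
    unfolding two_sided_inverse_def by (metis minus_mult_minus minus_minus)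
  from this[of "x + c *\<^sub>C 1"] show ?thesis
    by (auto simp add: unital_spectrum_def)
qed

lemma unital_spectrum_add: "c \<in> unital_spectrum (x + d *\<^sub>C 1) \<longleftrightarrow> c - d \<in> unital_spectrum x"
  by (simp add: unital_spectrum_def scaleC.scale_left_diff_distrib algebra_simps)

lemma norm_unital_spectrum_le:
  assumes "c \<in> unital_spectrum x"
  shows "cmod c \<le> norm x"
proof (rule ccontr)
  assume *: "\<not> cmod c \<le> norm x"
  then have c: "c \<noteq> 0"
    by auto
  then have "norm (inverse c *\<^sub>C x) < 1"
    unfolding norm_scaleC norm_inverse using * by (simp add: field_simps)
  then obtain y where "two_sided_inverse (1 - inverse c *\<^sub>C x) y"
    by (rule neumann_series)
  from two_sided_inverse_scaleC[OF _ this, of "- c"] show False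
    using c assms by (auto simp: unital_spectrum_def scaleC.scale_right_diff_distrib)
qed

lemma ex_unital_spectrum_norm:
  assumes "star h = h"
  obtains c where "c \<in> unital_spectrum h" "cmod c = norm h"
proof (cases "h = 0")
  case True
  then show thesis
    by (intro that[of 0]) (simp_all add: unital_spectrum_def two_sided_inverse_def)
next
  case False
  define g where "g = inverse (norm h) *\<^sub>R h"
  have "star g = g"
    using assms by (simp add: g_def star_scaleC flip: scaleC_of_real)
  moreover have "norm g = 1"
    using False by (simp add: g_def)
  ultimately obtain \<zeta> where \<zeta>: "cmod \<zeta> = 1" "\<nexists>u. two_sided_inverse (1 - \<zeta> *\<^sub>C g) u"
    using not_all_invertible_on_circle by blast
  \<comment> \<open>With \<open>g = h / norm h\<close>, the element
    \<open>1 - \<zeta> *\<^sub>C g\<close> is a nonzero multiple of \<open>h - c *\<^sub>C 1\<close>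
    for exactly this \<open>c\<close>, whose modulus is \<open>norm h\<close> because
    \<open>\<zeta>\<close> lies on the circle.\<close>
  define c where "c = of_real (norm h) / \<zeta>"
  have c: "cmod c = norm h" "c \<noteq> 0" "\<zeta> \<noteq> 0"
    using \<zeta>(1) False by (auto simp: c_def norm_divide)
  have "inverse c = \<zeta> * of_real (inverse (norm h))"
    by (simp add: c_def divide_inverse)
  then have "\<zeta> *\<^sub>C g = inverse c *\<^sub>C h"
    by (simp only: g_def scaleC_scaleC flip: scaleC_of_real)
  then have "(- inverse c) *\<^sub>C (h - c *\<^sub>C 1) = 1 - \<zeta> *\<^sub>C g"
    using c by (simp add: scaleC.scale_right_diff_distrib)
  then have "c \<in> unital_spectrum h"
    using \<zeta>(2) two_sided_inverse_scaleC[of "- inverse c" "h - c *\<^sub>C 1"] c(2)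
    by (auto simp: unital_spectrum_def)
  then show thesis
    using c(1) by (rule that)
qed

text \<open>A spectral value of modulus \<open>norm h\<close> that is nonnegative must be
  \<open>norm h\<close> itself; the shift moves it to \<open>s + norm h\<close>, which bounds the
  norm from below.\<close>

lemma norm_add_of_spectrum_nonneg:
  assumes "star h = h" "unital_spectrum h \<subseteq> \<real>\<^sub>\<ge>\<^sub>0" "0 \<le> s"
  shows "s + norm h \<le> norm (h + complex_of_real s *\<^sub>C 1)"
proof -
  obtain c where c: "c \<in> unital_spectrum h" "cmod c = norm h"
    using ex_unital_spectrum_norm[OF assms(1)] .
  then have "c = of_real (norm h)"
    using assms(2) by (auto elim!: nonneg_Reals_cases)
  then have "of_real (s + norm h) \<in> unital_spectrum (h + complex_of_real s *\<^sub>C 1)"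
    using c(1) by (simp add: unital_spectrum_add)
  from norm_unital_spectrum_le[OF this] show ?thesis
    using assms(3) by (simp flip: of_real_add)
qed

text \<open>Reflection sends a spectral value t of \<open>h\<close>, which lies between 0 and
  \<open>norm h\<close>, to s - t between 0 and s; the norm is the modulus of one of these.\<close>

lemma norm_diff_of_spectrum_nonneg:
  assumes "star h = h" "unital_spectrum h \<subseteq> \<real>\<^sub>\<ge>\<^sub>0" "norm h \<le> s"
  shows "norm (complex_of_real s *\<^sub>C 1 - h) \<le> s"
proof -
  let ?x = "complex_of_real s *\<^sub>C 1 - h"
  have "star ?x = ?x"
    by (simp add: star_diff star_scaleC assms(1))
  then obtain c where c: "c \<in> unital_spectrum ?x" "cmod c = norm ?x"
    by (rule ex_unital_spectrum_norm)
  have "of_real s - c \<in> unital_spectrum h"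
    using c(1) unital_spectrum_add[of c "- h" "of_real s"] unital_spectrum_uminus[of "c - of_real s" h]
    by simp
  moreover from this obtain t where t: "of_real s - c = of_real t" "0 \<le> t"
    using assms(2) by (auto elim!: nonneg_Reals_cases)
  ultimately have "t \<le> s"
    using norm_unital_spectrum_le[of "of_real s - c" h] assms(3) by simp
  moreover have "c = of_real (s - t)"
    using t(1) by (simp add: algebra_simps)
  then have "norm ?x = \<bar>s - t\<bar>"
    using c(2) by (metis norm_of_real real_norm_def)
  ultimately show ?thesis
    using t(2) by simp
qed

text \<open>Links the pair encoding in the definition of positivity to the normed unitization, where
  the spectral estimates apply.\<close>

lemma cstar_spectrum_eq_unital_spectrum:
  "cstar_spectrum a = unital_spectrum (Unitization 0 a)"
proof -
  have mult: "unitization_mult (c, x) (d, y) = (1, 0) \<longleftrightarrow>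
      Unitization c x * Unitization d y = 1" for c d and x y :: 'a
    by (simp add: unitization_mult_def unitization_defs)
  have "Unitization 0 a - c *\<^sub>C 1 = Unitization (- c) a" for c
    by (simp add: unitization_star_defs)
  then show ?thesis
    unfolding cstar_spectrum_def unital_spectrum_def two_sided_inverse_def
    by (auto simp: mult) (metis mult unitization.exhaust)+
qed

text \<open>Take s to be the norm of v. Then s + norm u is at most the norm of u + s, which splits
  as (u + v) + (s - v); the second summand has norm at most s, and s cancels.\<close>

lemma norm_le_norm_add_cstar_nonneg:
  fixes u v :: "'a::cstar_algebra"
  assumes "cstar_nonneg u" "cstar_nonneg v"
  shows "norm u \<le> norm (u + v)"
proof -
  let ?u = "Unitization 0 u" and ?v = "Unitization 0 v"
  have *: "star ?u = ?u" "unital_spectrum ?u \<subseteq> \<real>\<^sub>\<ge>\<^sub>0" "star ?v = ?v" "unital_spectrum ?v \<subseteq> \<real>\<^sub>\<ge>\<^sub>0"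
    using assms
    by (simp_all add: cstar_nonneg_def cstar_spectrum_eq_unital_spectrum star_unitization_def)
  define s where "s = norm v"
  have "s + norm ?u \<le> norm (?u + complex_of_real s *\<^sub>C 1)"
    by (rule norm_add_of_spectrum_nonneg) (simp_all add: * s_def)
  also have "?u + complex_of_real s *\<^sub>C 1 = Unitization 0 (u + v) + (complex_of_real s *\<^sub>C 1 - ?v)"
    by (simp add: unitization_star_defs)
  also have "norm \<dots> \<le> norm (Unitization 0 (u + v)) + norm (complex_of_real s *\<^sub>C 1 - ?v)"
    by (rule norm_triangle_ineq)
  also have "norm (complex_of_real s *\<^sub>C 1 - ?v) \<le> s"
    by (rule norm_diff_of_spectrum_nonneg) (simp_all add: * s_def norm_Unitization_0)
  finally show ?thesis
    by (simp add: norm_Unitization_0)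
qed

subsection \<open>Semi-inner products and differentiation\<close>

text \<open>With the full carrier the membership premises of the axioms are discharged once and for
  all.\<close>

locale total_semi_inner_product_cstar_module = semi_inner_product_cstar_module scaleX UNIV act ip
  for scaleX :: "complex \<Rightarrow> 'x \<Rightarrow> 'x::ab_group_add" and act :: "'x \<Rightarrow> 'a::cstar_algebra \<Rightarrow> 'x"
    and ip :: "'x \<Rightarrow> 'x \<Rightarrow> 'a"
begin

lemma star_ip_eq [simp]: "star (ip x y) = ip y x"
  by (simp add: star_ip)

lemma ip_right_distrib: "ip x (y + z) = ip x y + ip x z"
  by (simp add: ip_add_right)

lemma ip_left_distrib: "ip (x + y) z = ip x z + ip y z"
  by (metis ip_right_distrib star_add star_ip_eq)

lemma ip_zero_right [simp]: "ip x 0 = 0"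
  using ip_right_distrib[of x 0 0] by simp

lemma ip_zero_left [simp]: "ip 0 x = 0"
  using ip_left_distrib[of 0 0 x] by simp

lemma ip_right_diff_distrib: "ip x (y - z) = ip x y - ip x z"
  using ip_right_distrib[of x "y - z" z] by (simp add: algebra_simps)

lemma ip_left_diff_distrib: "ip (x - y) z = ip x z - ip y z"
  using ip_left_distrib[of "x - y" y z] by (simp add: algebra_simps)

lemmas ip_distribs =
  ip_right_distrib ip_left_distrib ip_right_diff_distrib ip_left_diff_distrib

lemma ip_act_eq: "ip x (act y a) = ip x y * a"
  by (simp add: ip_act_right)

lemma ip_act_left: "ip (act x a) y = star a * ip x y"
  by (metis ip_act_eq star_ip_eq star_mult)

text \<open>Without a unit, complex homogeneity has to be tested against all \<open>a\<close> in the algebra.\<close>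

lemma ip_scale_right: "ip x (scaleX c y) = c *\<^sub>C ip x y"
proof -
  have "(ip x (scaleX c y) - c *\<^sub>C ip x y) * a = 0" for a
  proof -
    have "ip x (scaleX c y) * a = ip x (act y (c *\<^sub>C a))"
      by (simp add: act_scale_left act_scale_right flip: ip_act_eq)
    then show ?thesis
      by (simp add: ip_act_eq left_diff_distrib mult_scaleC_left mult_scaleC_right)
  qed
  then show ?thesis
    using mult_right_eq_0_imp eq_iff_diff_eq_0 by blast
qed

lemma ip_scale_left: "ip (scaleX c x) y = cnj c *\<^sub>C ip x y"
  by (metis ip_scale_right star_ip_eq star_scaleC)

lemma act_diff_left: "act (x - y) a = act x a - act y a"
  using act_add_left[of "x - y" y a] by (simp add: algebra_simps)

section \<open>The seminorm and the Cauchy-Schwarz estimate\<close>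

abbreviation snorm :: "'x \<Rightarrow> real" where
  "snorm \<equiv> ip_seminorm ip"

lemma snorm_nonneg [simp]: "0 \<le> snorm x"
  by (simp add: ip_seminorm_def)

lemma snorm_power2: "(snorm x)\<^sup>2 = norm (ip x x)"
  by (simp add: ip_seminorm_def)

lemma snorm_zero [simp]: "snorm 0 = 0"
  by (simp add: ip_seminorm_def)

lemma snorm_leI: "norm (ip x x) \<le> b\<^sup>2 \<Longrightarrow> 0 \<le> b \<Longrightarrow> snorm x \<le> b"
  by (simp add: ip_seminorm_def real_le_lsqrt)

lemma snorm_scale: "snorm (scaleX c x) = cmod c * snorm x"
  by (simp add: ip_seminorm_def ip_scale_left ip_scale_right scaleC_scaleC norm_scaleC real_sqrt_mult
      complex_mod_mult_cnj)

lemma snorm_minus [simp]: "snorm (- x) = snorm x"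
  using snorm_scale[of "- 1" x] by simp

lemma snorm_act_le: "snorm (act x a) \<le> norm a * snorm x"
proof (rule snorm_leI)
  have "norm (ip (act x a) (act x a)) \<le> norm (star a * ip x x) * norm a"
    by (simp add: ip_act_left ip_act_eq norm_mult_ineq flip: mult.assoc)
  also have "\<dots> \<le> (norm (star a) * norm (ip x x)) * norm a"
    by (intro mult_right_mono norm_mult_ineq norm_ge_zero)
  finally show "norm (ip (act x a) (act x a)) \<le> (norm a * snorm x)\<^sup>2"
    by (simp add: power_mult_distrib snorm_power2) (simp add: power2_eq_square mult_ac)
qed simp

text \<open>The parallelogram law: adding the positive element \<open>ip (x - y) (x - y)\<close>
  cannot decrease the norm, and it cancels the mixed terms. This is where positivity enters the
  estimates.\<close>

lemma snorm_add_power2_le: "(snorm (x + y))\<^sup>2 \<le> 2 * ((snorm x)\<^sup>2 + (snorm y)\<^sup>2)"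
proof -
  have "norm (ip (x + y) (x + y)) \<le> norm (ip (x + y) (x + y) + ip (x - y) (x - y))"
    by (intro norm_le_norm_add_cstar_nonneg ip_nonneg) simp_all
  also have "ip (x + y) (x + y) + ip (x - y) (x - y) = 2 *\<^sub>R (ip x x + ip y y)"
    by (simp add: ip_distribs scaleR_2)
  also have "norm \<dots> \<le> 2 * (norm (ip x x) + norm (ip y y))"
    using norm_triangle_ineq[of "ip x x" "ip y y"] by simp
  finally show ?thesis
    by (simp add: snorm_power2)
qed

text \<open>A factor \<open>2\<close> in the triangle inequality is harmless in limits.\<close>

lemma snorm_add_le: "snorm (x + y) \<le> 2 * (snorm x + snorm y)"
proof (rule power2_le_imp_le)
  have "2 * ((snorm x)\<^sup>2 + (snorm y)\<^sup>2) \<le> (2 * (snorm x + snorm y))\<^sup>2"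
    by (simp add: power2_sum power_mult_distrib)
  then show "(snorm (x + y))\<^sup>2 \<le> (2 * (snorm x + snorm y))\<^sup>2"
    using snorm_add_power2_le order_trans by blast
qed simp

text \<open>Multiplication by \<open>\<i>\<close> preserves the seminorm, so each of the four
  squares in the polarization identity is at most twice the sum of squares; 8 divided by 4 leaves
  2.\<close>

lemma norm_ip_le_polarization: "norm (ip x y) \<le> 2 * ((snorm x)\<^sup>2 + (snorm y)\<^sup>2)"
proof -
  let ?y = "scaleX \<i> y"
  have four: "4 *\<^sub>R a = (a + a) + (a + a)" for a :: 'a
    using scaleR_add_left[of 2 2 a] by (simp add: scaleR_2)
  have "4 *\<^sub>R ip x y = (ip (x + y) (x + y) - ip (x - y) (x - y)) -
      \<i> *\<^sub>C (ip (x + ?y) (x + ?y) - ip (x - ?y) (x - ?y))"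
    by (simp add: ip_distribs ip_scale_left ip_scale_right scaleC_scaleC
        scaleC.scale_right_diff_distrib scaleC_add_right four)
  then have "norm (4 *\<^sub>R ip x y) \<le> norm (ip (x + y) (x + y) - ip (x - y) (x - y)) +
      norm (ip (x + ?y) (x + ?y) - ip (x - ?y) (x - ?y))"
    by (metis norm_triangle_ineq4 norm_scaleC norm_ii mult_1)
  also have "\<dots> \<le> (norm (ip (x + y) (x + y)) + norm (ip (x - y) (x - y))) +
      (norm (ip (x + ?y) (x + ?y)) + norm (ip (x - ?y) (x - ?y)))"
    by (intro add_mono norm_triangle_ineq4)
  also have "\<dots> \<le> 8 * ((snorm x)\<^sup>2 + (snorm y)\<^sup>2)"
    using snorm_add_power2_le[of x y] snorm_add_power2_le[of x "- y"]
      snorm_add_power2_le[of x ?y] snorm_add_power2_le[of x "- ?y"]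
    by (simp add: snorm_scale flip: snorm_power2)
  finally show ?thesis
    by simp
qed

text \<open>Rescaling \<open>y\<close> by \<open>s / t\<close> balances the two squares in the
  polarization bound and turns their sum into a product. The \<open>\<epsilon>\<close> keeps both
  factors positive when a vector is null, and is sent to 0 at the end.\<close>

lemma norm_ip_le: "norm (ip x y) \<le> 4 * (snorm x * snorm y)"
proof -
  have le: "norm (ip x y) \<le> 4 * ((snorm x + \<epsilon>) * (snorm y + \<epsilon>))" if "0 < \<epsilon>" for \<epsilon>
  proof -
    define s t where "s = snorm x + \<epsilon>" and "t = snorm y + \<epsilon>"
    have pos: "0 < s" "0 < t"
      using that by (simp_all add: s_def t_def add_nonneg_pos)
    have "s / t * norm (ip x y) \<le> 2 * ((snorm x)\<^sup>2 + (s / t * snorm y)\<^sup>2)"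
      using norm_ip_le_polarization[of x "scaleX (of_real (s / t)) y"] pos
      by (simp add: ip_scale_right norm_scaleC snorm_scale norm_divide)
    also have "\<dots> \<le> 2 * (s\<^sup>2 + (s / t * t)\<^sup>2)"
      using that pos by (intro mult_left_mono add_mono power_mono) (simp_all add: s_def t_def)
    also have "\<dots> = s / t * (4 * (s * t))"
      using pos by (simp add: power2_eq_square)
    finally have "norm (ip x y) \<le> 4 * (s * t)"
      using pos by (simp only: mult_le_cancel_left_pos divide_pos_pos)
    then show ?thesis
      by (simp only: s_def t_def)
  qed
  have "((\<lambda>\<epsilon>. 4 * ((snorm x + \<epsilon>) * (snorm y + \<epsilon>))) \<longlongrightarrow> 4 * ((snorm x + 0) * (snorm y + 0)))
      (at_right 0)"
    by (intro tendsto_intros)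
  moreover have "\<forall>\<^sub>F \<epsilon> in at_right 0. norm (ip x y) \<le> 4 * ((snorm x + \<epsilon>) * (snorm y + \<epsilon>))"
    using le by (auto simp: eventually_at_right_field intro: exI[of _ 1])
  ultimately show ?thesis
    using tendsto_lowerbound by fastforce
qed

lemma ip_eq_0_right: "snorm x = 0 \<Longrightarrow> ip y x = 0"
  using norm_ip_le[of y x] by simp

section \<open>Derivatives of module-valued maps\<close>

lemma linear_scaleX_iff: "Vector_Spaces.linear scaleC scaleX u \<longleftrightarrow>
    (\<forall>x y. u (x + y) = u x + u y) \<and> (\<forall>c x. u (c *\<^sub>C x) = scaleX c (u x))"
  by (simp add: Vector_Spaces.linear_iff vector_space_scaleC vector_space_axioms)

abbreviation has_deriv :: "('a \<Rightarrow> 'x) \<Rightarrow> ('a \<Rightarrow> 'x) \<Rightarrow> 'a \<Rightarrow> bool" where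
  "has_deriv \<equiv> has_module_derivative scaleX ip"

lemma has_derivI:
  assumes "\<And>x y. u (x + y) = u x + u y" "\<And>c x. u (c *\<^sub>C x) = scaleX c (u x)"
    "\<And>h. snorm (u h) \<le> K * norm h"
    "((\<lambda>h. snorm (f (q + h) - f q - u h) / norm h) \<longlongrightarrow> 0) (at 0)"
  shows "has_deriv f u q"
  unfolding has_module_derivative_def linear_scaleX_iff using assms by blast

lemma has_derivD:
  assumes "has_deriv f u q"
  shows "u (x + y) = u x + u y" "u (c *\<^sub>C x) = scaleX c (u x)"
    "((\<lambda>h. snorm (f (q + h) - f q - u h) / norm h) \<longlongrightarrow> 0) (at 0)"
  using assms unfolding has_module_derivative_def linear_scaleX_iff by blast+

lemma has_deriv_bound:
  assumes "has_deriv f u q"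
  obtains K where "0 \<le> K" "\<And>h. snorm (u h) \<le> K * norm h"
proof -
  obtain K where K: "\<And>h. snorm (u h) \<le> K * norm h"
    using assms unfolding has_module_derivative_def by blast
  show thesis
  proof (rule that)
    show "snorm (u h) \<le> \<bar>K\<bar> * norm h" for h
      using K[of h] mult_right_mono[OF abs_ge_self[of K] norm_ge_zero[of h]] by linarith
  qed simp
qed

text \<open>The general denominator serves two purposes: \<open>r h = h\<close> gives difference
  quotients, the constant 1 gives continuity.\<close>

lemma tendsto_snorm_zero_add:
  assumes "((\<lambda>h. snorm (f h) / norm (r h)) \<longlongrightarrow> 0) F" "((\<lambda>h. snorm (g h) / norm (r h)) \<longlongrightarrow> 0) F"
  shows "((\<lambda>h. snorm (f h + g h) / norm (r h)) \<longlongrightarrow> 0) F"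
proof (rule Lim_null_comparison)
  have "snorm (f h + g h) / norm (r h) \<le> 2 * (snorm (f h) / norm (r h) + snorm (g h) / norm (r h))" for h
    using divide_right_mono[OF snorm_add_le[of "f h" "g h"] norm_ge_zero[of "r h"]]
    by (simp add: add_divide_distrib)
  then show "\<forall>\<^sub>F h in F. norm (snorm (f h + g h) / norm (r h)) \<le>
      2 * (snorm (f h) / norm (r h) + snorm (g h) / norm (r h))"
    by simp
  show "((\<lambda>h. 2 * (snorm (f h) / norm (r h) + snorm (g h) / norm (r h))) \<longlongrightarrow> 0) F"
    by (intro tendsto_mult_right_zero tendsto_add_zero assms)
qed

lemma tendsto_snorm_zero_image:
  assumes "((\<lambda>h. snorm (f h) / norm (r h)) \<longlongrightarrow> 0) F" "\<And>x. snorm (L x) \<le> C * snorm x"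
  shows "((\<lambda>h. snorm (L (f h)) / norm (r h)) \<longlongrightarrow> 0) F"
proof (rule Lim_null_comparison)
  have "snorm (L (f h)) / norm (r h) \<le> C * (snorm (f h) / norm (r h))" for h
    using divide_right_mono[OF assms(2)[of "f h"] norm_ge_zero[of "r h"]] by simp
  then show "\<forall>\<^sub>F h in F. norm (snorm (L (f h)) / norm (r h)) \<le> C * (snorm (f h) / norm (r h))"
    by simp
  show "((\<lambda>h. C * (snorm (f h) / norm (r h))) \<longlongrightarrow> 0) F"
    by (intro tendsto_mult_right_zero assms(1))
qed

lemma has_deriv_const: "has_deriv (\<lambda>_. x) (\<lambda>_. 0) q"
  by (rule has_derivI[where K = 0]) simp_all

lemma has_deriv_add:
  assumes f: "has_deriv f u q" and g: "has_deriv g v q"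
  shows "has_deriv (\<lambda>t. f t + g t) (\<lambda>h. u h + v h) q"
proof -
  obtain K L where K: "\<And>h. snorm (u h) \<le> K * norm h" and L: "\<And>h. snorm (v h) \<le> L * norm h"
    using has_deriv_bound[OF f] has_deriv_bound[OF g] by metis
  show ?thesis
  proof (rule has_derivI)
    show "snorm (u h + v h) \<le> 2 * (K + L) * norm h" for h
      using snorm_add_le[of "u h" "v h"] K[of h] L[of h] by (simp add: algebra_simps)
    show "((\<lambda>h. snorm (f (q + h) + g (q + h) - (f q + g q) - (u h + v h)) / norm h) \<longlongrightarrow> 0) (at 0)"
      using tendsto_snorm_zero_add[OF has_derivD(3)[OF f] has_derivD(3)[OF g]]
      by (simp add: algebra_simps)
  qed (simp_all add: has_derivD[OF f] has_derivD[OF g] scale_right_distrib)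
qed

text \<open>Treats the right action of an algebra element and multiplication by a complex scalar at
  the same time.\<close>

lemma has_deriv_image:
  assumes f: "has_deriv f u q"
    and L: "\<And>x y. L (x - y) = L x - L y" "\<And>x y. L (x + y) = L x + L y"
      "\<And>c x. L (scaleX c x) = scaleX c (L x)" "\<And>x. snorm (L x) \<le> C * snorm x" "0 \<le> C"
  shows "has_deriv (\<lambda>t. L (f t)) (\<lambda>h. L (u h)) q"
proof -
  obtain K where K: "\<And>h. snorm (u h) \<le> K * norm h"
    using has_deriv_bound[OF f] by metis
  show ?thesis
  proof (rule has_derivI)
    show "snorm (L (u h)) \<le> C * K * norm h" for h
      using L(4)[of "u h"] mult_left_mono[OF K L(5), of h] by simp
    show "((\<lambda>h. snorm (L (f (q + h)) - L (f q) - L (u h)) / norm h) \<longlongrightarrow> 0) (at 0)"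
      using tendsto_snorm_zero_image[OF has_derivD(3)[OF f] L(4)] by (simp add: L(1))
  qed (simp_all add: has_derivD[OF f] L(2,3))
qed

lemma has_deriv_act: "has_deriv f u q \<Longrightarrow> has_deriv (\<lambda>t. act (f t) b) (\<lambda>h. act (u h) b) q"
  by (erule has_deriv_image[where C = "norm b"])
    (simp_all add: act_add_left act_diff_left act_scale_left snorm_act_le)

text \<open>The difference of the two derivatives is homogeneous, so along the ray through
  \<open>h\<close> its quotient by the norm is constant; that constant must equal its limit
  0.\<close>

lemma has_deriv_unique:
  assumes u: "has_deriv f u q" and v: "has_deriv f v q"
  shows "snorm (u h - v h) = 0"
proof (cases "h = 0")
  case True
  have "u 0 = 0" "v 0 = 0"
    using has_derivD(2)[OF u, of 0 0] has_derivD(2)[OF v, of 0 0] by simp_all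
  then show ?thesis
    using True by simp
next
  case False
  let ?w = "\<lambda>h. u h - v h"
  have "((\<lambda>h. snorm (- (f (q + h) - f q - u h)) / norm h) \<longlongrightarrow> 0) (at 0)"
    using has_derivD(3)[OF u] by (simp only: snorm_minus)
  from tendsto_snorm_zero_add[OF this has_derivD(3)[OF v]]
  have lim: "((\<lambda>h. snorm (?w h) / norm h) \<longlongrightarrow> 0) (at 0)"
    by (simp add: algebra_simps)
  have "filterlim (\<lambda>t::real. t *\<^sub>R h) (at 0) (at_right 0)"
  proof (rule filterlim_atI)
    have "((\<lambda>t::real. t *\<^sub>R h) \<longlongrightarrow> 0 *\<^sub>R h) (at_right 0)"
      by (intro tendsto_intros)
    then show "((\<lambda>t::real. t *\<^sub>R h) \<longlongrightarrow> 0) (at_right 0)"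
      by simp
    show "\<forall>\<^sub>F t::real in at_right 0. t *\<^sub>R h \<noteq> 0"
      using False by (auto simp: eventually_at_right_field intro: exI[of _ 1])
  qed
  from filterlim_compose[OF lim this]
  have "((\<lambda>t. snorm (?w (t *\<^sub>R h)) / norm (t *\<^sub>R h)) \<longlongrightarrow> 0) (at_right (0::real))" .
  moreover have "snorm (?w (t *\<^sub>R h)) / norm (t *\<^sub>R h) = snorm (?w h) / norm h" if "0 < t" for t :: real
  proof -
    have "?w (t *\<^sub>R h) = scaleX (of_real t) (?w h)"
      using has_derivD(2)[OF u, of "of_real t" h] has_derivD(2)[OF v, of "of_real t" h]
      by (simp add: scaleC_of_real scale_right_diff_distrib)
    then show ?thesis
      using that by (simp add: snorm_scale)
  qed
  then have "\<forall>\<^sub>F t in at_right (0::real).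
      snorm (?w (t *\<^sub>R h)) / norm (t *\<^sub>R h) = snorm (?w h) / norm h"
    by (auto simp: eventually_at_right_field intro: exI[of _ 1])
  ultimately have "((\<lambda>t. snorm (?w h) / norm h) \<longlongrightarrow> 0) (at_right (0::real))"
    using tendsto_cong by fast
  then have "snorm (?w h) / norm h = 0"
    by (simp add: tendsto_const_iff)
  then show ?thesis
    using False by simp
qed

text \<open>The remainder splits into three inner products, pairing the remainder of
  \<open>f\<close> with \<open>g (q + h)\<close>, \<open>f q\<close> with the remainder of
  \<open>g\<close>, and \<open>u h\<close> with the increment of \<open>g\<close>. Continuity of
  \<open>g\<close> bounds the first and makes the last small relative to
  \<open>norm h\<close>.\<close>

lemma has_derivative_ip:
  assumes f: "has_deriv f u q" and g: "has_deriv g v q"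
    and cont: "((\<lambda>t. snorm (g t - g q)) \<longlongrightarrow> 0) (at q)"
  shows "((\<lambda>t. ip (f t) (g t)) has_derivative (\<lambda>h. ip (u h) (g q) + ip (f q) (v h))) (at q)"
proof -
  obtain K where K: "0 \<le> K" "\<And>h. snorm (u h) \<le> K * norm h"
    using has_deriv_bound[OF f] by metis
  obtain L where L: "0 \<le> L" "\<And>h. snorm (v h) \<le> L * norm h"
    using has_deriv_bound[OF g] by metis
  have "bounded_linear (\<lambda>h. ip (u h) (g q))"
  proof (rule bounded_linear_intro[where K = "4 * (K * snorm (g q))"])
    show "ip (u (r *\<^sub>R h)) (g q) = r *\<^sub>R ip (u h) (g q)" for r h
      using has_derivD(2)[OF f, of "of_real r" h] by (simp add: scaleC_of_real ip_scale_left)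
    show "norm (ip (u h) (g q)) \<le> norm h * (4 * (K * snorm (g q)))" for h
      using norm_ip_le[of "u h" "g q"] mult_right_mono[OF K(2)[of h] snorm_nonneg[of "g q"]]
      by (simp add: mult_ac)
  qed (simp add: has_derivD[OF f] ip_left_distrib)
  moreover have "bounded_linear (\<lambda>h. ip (f q) (v h))"
  proof (rule bounded_linear_intro[where K = "4 * (snorm (f q) * L)"])
    show "ip (f q) (v (r *\<^sub>R h)) = r *\<^sub>R ip (f q) (v h)" for r h
      using has_derivD(2)[OF g, of "of_real r" h] by (simp add: scaleC_of_real ip_scale_right)
    show "norm (ip (f q) (v h)) \<le> norm h * (4 * (snorm (f q) * L))" for h
      using norm_ip_le[of "f q" "v h"] mult_left_mono[OF L(2)[of h] snorm_nonneg[of "f q"]]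
      by (simp add: mult_ac)
  qed (simp add: has_derivD[OF g] ip_right_distrib)
  ultimately have linear: "bounded_linear (\<lambda>h. ip (u h) (g q) + ip (f q) (v h))"
    by (rule bounded_linear_add)
  let ?\<rho> = "\<lambda>h. f (q + h) - f q - u h" and ?\<sigma> = "\<lambda>h. g (q + h) - g q - v h"
    and ?\<delta> = "\<lambda>h. g (q + h) - g q"
  \<comment> \<open>The factors 4 come from \<open>norm_ip_le\<close>, the factor 2 from bounding
    \<open>g (q + h)\<close> by \<open>snorm_add_le\<close>.\<close>
  define B where "B h = 4 * (snorm (?\<rho> h) / norm h * (2 * (snorm (?\<delta> h) + snorm (g q)))) +
    4 * (snorm (f q) * (snorm (?\<sigma> h) / norm h)) + 4 * (K * snorm (?\<delta> h))" for h
  have "((\<lambda>h. snorm (?\<delta> h)) \<longlongrightarrow> 0) (at 0)"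
    using LIM_offset_zero[OF cont] .
  then have "(B \<longlongrightarrow> 4 * (0 * (2 * (0 + snorm (g q)))) + 4 * (snorm (f q) * 0) + 4 * (K * 0)) (at 0)"
    unfolding B_def by (intro tendsto_intros has_derivD(3)[OF f] has_derivD(3)[OF g])
  then have B: "(B \<longlongrightarrow> 0) (at 0)"
    by simp
  have "norm (ip (f (q + h)) (g (q + h)) - ip (f q) (g q) - (ip (u h) (g q) + ip (f q) (v h))) / norm h
      \<le> B h" if "h \<noteq> 0" for h
  proof -
    have "ip (f (q + h)) (g (q + h)) - ip (f q) (g q) - (ip (u h) (g q) + ip (f q) (v h)) =
        ip (?\<rho> h) (g (q + h)) + ip (f q) (?\<sigma> h) + ip (u h) (?\<delta> h)"
      by (simp add: ip_distribs algebra_simps)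
    also have "norm \<dots> \<le> norm (ip (?\<rho> h) (g (q + h))) + norm (ip (f q) (?\<sigma> h)) +
        norm (ip (u h) (?\<delta> h))"
      by (intro norm_triangle_mono order_refl)
    also have "\<dots> \<le> 4 * (snorm (?\<rho> h) * snorm (g (q + h))) + 4 * (snorm (f q) * snorm (?\<sigma> h)) +
        4 * (snorm (u h) * snorm (?\<delta> h))"
      by (intro add_mono norm_ip_le)
    also have "\<dots> \<le> 4 * (snorm (?\<rho> h) * (2 * (snorm (?\<delta> h) + snorm (g q)))) +
        4 * (snorm (f q) * snorm (?\<sigma> h)) + 4 * (K * norm h * snorm (?\<delta> h))"
      using snorm_add_le[of "?\<delta> h" "g q"] K(2)[of h]
      by (intro add_mono mult_left_mono mult_right_mono) simp_all
    also have "\<dots> = B h * norm h"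
      using that by (simp add: B_def distrib_right)
    finally show ?thesis
      using that by (simp add: pos_divide_le_eq)
  qed
  then have "\<forall>\<^sub>F h in at 0. norm (norm (ip (f (q + h)) (g (q + h)) - ip (f q) (g q) -
      (ip (u h) (g q) + ip (f q) (v h))) / norm h) \<le> B h"
    by (auto simp: eventually_at_filter)
  from Lim_null_comparison[OF this B] show ?thesis
    unfolding has_derivative_at using linear by blast
qed

section \<open>The form \<open>ip1\<close> and null vectors\<close>

lemma ip1_right_distrib: "ip1 ip e x (y + z) = ip1 ip e x y + ip1 ip e x z"
  by (simp add: ip1_def ip_distribs algebra_simps)

lemma ip1_right_diff_distrib: "ip1 ip e x (y - z) = ip1 ip e x y - ip1 ip e x z"
  by (simp add: ip1_def ip_distribs algebra_simps)

lemma ip1_left_diff_distrib: "ip1 ip e (x - y) z = ip1 ip e x z - ip1 ip e y z"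
  by (simp add: ip1_def ip_distribs algebra_simps)

lemma ip1_act_right: "ip1 ip e x (act y a) = ip1 ip e x y * a"
  by (simp add: ip1_def ip_act_eq algebra_simps)

lemma star_ip1: "star (ip1 ip e x y) = ip1 ip e y x"
  by (simp add: ip1_def star_diff star_mult)

text \<open>Allows a derivative to be exchanged for another one, which differs from it by null
  vectors only.\<close>

lemma ip1_cong_right:
  assumes "snorm (y - z) = 0"
  shows "ip1 ip e x y = ip1 ip e x z"
proof -
  have "ip1 ip e x (y - z) = 0"
    using assms by (simp add: ip1_def ip_eq_0_right)
  then show ?thesis
    by (simp add: ip1_right_diff_distrib)
qed

text \<open>The idempotent is a projection and \<open>e - e \<langle>e, e\<rangle>\<close> is a null vector, so \<open>\<langle>x, x\<rangle>\<^sub>1\<close> is the inner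
  square of the component \<open>x - e \<langle>e, x\<rangle>\<close> of \<open>x\<close> orthogonal to \<open>e\<close>.\<close>

lemma ip1_nonneg:
  assumes e: "ip e e * ip e e = ip e e"
  shows "cstar_nonneg (ip1 ip e x x)"
proof -
  define P where "P = ip e e"
  have P: "P * P = P" "star P = P"
    using e by (simp_all add: P_def)
  have "ip (e - act e P) (e - act e P) = 0"
    by (simp add: ip_distribs ip_act_eq ip_act_left P flip: P_def)
  then have "snorm (e - act e P) = 0"
    by (simp add: ip_seminorm_def)
  then have "ip x (e - act e P) = 0"
    by (rule ip_eq_0_right)
  \<comment> \<open>The identity between \<open>e\<close> and \<open>act e P\<close> is available
    only inside inner products. It turns the last term of \<open>ip y y\<close> into
    \<open>ip x e * ip e x\<close>, which cancels one of the two subtracted copies.\<close>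
  then have xP: "ip x e * P = ip x e"
    by (simp add: ip_distribs ip_act_eq)
  define y where "y = x - act e (ip e x)"
  have "ip y y = ip x x - ip x e * ip e x - ip x e * ip e x + (ip x e * P) * ip e x"
    by (simp add: y_def ip_distribs ip_act_eq ip_act_left P_def algebra_simps)
  also have "\<dots> = ip1 ip e x x"
    by (simp add: xP ip1_def)
  finally show ?thesis
    using ip_nonneg[of y] by simp
qed

section \<open>The module of differentiable functions\<close>

abbreviation diff_near :: "'a \<Rightarrow> ('a \<Rightarrow> 'x) set" where
  "diff_near \<equiv> differentiable_near scaleX ip"

lemma diff_nearI:
  assumes "\<And>q. ((\<lambda>t. snorm (f t - f q)) \<longlongrightarrow> 0) (at q)"
    "open U" "p \<in> U" "\<And>q. q \<in> U \<Longrightarrow> \<exists>u. has_deriv f u q"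
  shows "f \<in> diff_near p"
  using assms unfolding differentiable_near_def by blast

lemma diff_nearE:
  assumes "f \<in> diff_near p"
  obtains U where "\<And>q. ((\<lambda>t. snorm (f t - f q)) \<longlongrightarrow> 0) (at q)"
    "open U" "p \<in> U" "\<And>q. q \<in> U \<Longrightarrow> \<exists>u. has_deriv f u q"
  using assms unfolding differentiable_near_def by blast

lemma has_deriv_module_derivative:
  assumes "f \<in> diff_near p"
  shows "has_deriv f (module_derivative scaleX ip f p) p"
proof -
  have "\<exists>u. has_deriv f u p"
    using assms by (auto elim: diff_nearE)
  then show ?thesis
    unfolding module_derivative_def by (rule someI_ex)
qed

lemma diff_near_zero: "0 \<in> diff_near p"
  by (rule diff_nearI[where U = UNIV]) (auto simp: zero_fun_def intro: has_deriv_const)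

lemma diff_near_add:
  assumes "f \<in> diff_near p" "g \<in> diff_near p"
  shows "f + g \<in> diff_near p"
proof -
  obtain U where f: "\<And>q. ((\<lambda>t. snorm (f t - f q)) \<longlongrightarrow> 0) (at q)"
    and U: "open U" "p \<in> U" "\<And>q. q \<in> U \<Longrightarrow> \<exists>u. has_deriv f u q"
    using diff_nearE[OF assms(1)] by metis
  obtain V where g: "\<And>q. ((\<lambda>t. snorm (g t - g q)) \<longlongrightarrow> 0) (at q)"
    and V: "open V" "p \<in> V" "\<And>q. q \<in> V \<Longrightarrow> \<exists>u. has_deriv g u q"
    using diff_nearE[OF assms(2)] by metis
  show ?thesis
  proof (rule diff_nearI)
    show "((\<lambda>t. snorm ((f + g) t - (f + g) q)) \<longlongrightarrow> 0) (at q)" for q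
      using tendsto_snorm_zero_add[where r = "\<lambda>_. 1 :: real"] f[of q] g[of q]
      by (fastforce simp: algebra_simps)
    show "open (U \<inter> V)" "p \<in> U \<inter> V"
      using U V by auto
    show "\<exists>u. has_deriv (f + g) u q" if "q \<in> U \<inter> V" for q
      using U(3) V(3) that unfolding plus_fun_def by (blast intro: has_deriv_add)
  qed
qed

lemma diff_near_image:
  assumes "f \<in> diff_near p"
    and L: "\<And>x y. L (x - y) = L x - L y" "\<And>x y. L (x + y) = L x + L y"
      "\<And>c x. L (scaleX c x) = scaleX c (L x)" "\<And>x. snorm (L x) \<le> C * snorm x" "0 \<le> C"
  shows "(\<lambda>t. L (f t)) \<in> diff_near p"
proof -
  obtain U where f: "\<And>q. ((\<lambda>t. snorm (f t - f q)) \<longlongrightarrow> 0) (at q)"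
    and U: "open U" "p \<in> U" "\<And>q. q \<in> U \<Longrightarrow> \<exists>u. has_deriv f u q"
    using diff_nearE[OF assms(1)] by metis
  show ?thesis
  proof (rule diff_nearI)
    show "((\<lambda>t. snorm (L (f t) - L (f q))) \<longlongrightarrow> 0) (at q)" for q
      using tendsto_snorm_zero_image[where r = "\<lambda>_. 1 :: real", OF _ L(4)] f[of q]
      by (simp flip: L(1))
    show "\<exists>u. has_deriv (\<lambda>t. L (f t)) u q" if "q \<in> U" for q
      using U(3)[OF that] has_deriv_image[OF _ L] by blast
  qed (use U in auto)
qed

lemma diff_near_scale: "f \<in> diff_near p \<Longrightarrow> (\<lambda>t. scaleX c (f t)) \<in> diff_near p"
  by (erule diff_near_image[where C = "cmod c"])
    (simp_all add: scale_right_distrib scale_right_diff_distrib scale_left_commute snorm_scale)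

lemma diff_near_act: "f \<in> diff_near p \<Longrightarrow> (\<lambda>t. act (f t) b) \<in> diff_near p"
  by (erule diff_near_image[where C = "norm b"])
    (simp_all add: act_add_left act_diff_left act_scale_left snorm_act_le)

lemma has_derivative_ip1:
  assumes f: "f \<in> diff_near p" and g: "g \<in> diff_near p"
    and u: "has_deriv f u p" and v: "has_deriv g v p"
  shows "((\<lambda>t. ip1 ip e (f t) (g t)) has_derivative
    (\<lambda>h. ip1 ip e (u h) (g p) + ip1 ip e (f p) (v h))) (at p)"
proof -
  have cont: "((\<lambda>t. snorm (g t - g p)) \<longlongrightarrow> 0) (at p)"
    using g by (auto elim: diff_nearE)
  have fe: "((\<lambda>t. ip (f t) e) has_derivative (\<lambda>h. ip (u h) e)) (at p)"
    using has_derivative_ip[OF u has_deriv_const[of e]] by simp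
  have eg: "((\<lambda>t. ip e (g t)) has_derivative (\<lambda>h. ip e (v h))) (at p)"
    using has_derivative_ip[OF has_deriv_const[of e] v cont] by simp
  show ?thesis
    unfolding ip1_def
    by (rule has_derivative_eq_rhs[OF has_derivative_diff[OF has_derivative_ip[OF u v cont]
          has_derivative_mult[OF fe eg]]])
      (simp add: algebra_simps)
qed

text \<open>Respects sums and the right action only up to null vectors, because
  \<open>module_derivative\<close> is a choice.\<close>

definition increment :: "'a \<Rightarrow> 'a \<Rightarrow> ('a \<Rightarrow> 'x) \<Rightarrow> 'x" where
  "increment p a f = module_derivative scaleX ip f p a - f p"

lemma derivative_ip_eq:
  assumes "f \<in> diff_near p" "g \<in> diff_near p"
  shows "derivative_ip scaleX ip e p a f g = ip1 ip e (increment p a f) (increment p a g)"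
proof -
  let ?u = "module_derivative scaleX ip f p" and ?v = "module_derivative scaleX ip g p"
  have "((\<lambda>t. ip1 ip e (f t) (g t)) has_derivative
      (\<lambda>h. ip1 ip e (?u h) (g p) + ip1 ip e (f p) (?v h))) (at p)"
    using assms by (intro has_derivative_ip1 has_deriv_module_derivative)
  then have "frechet_derivative (\<lambda>t. ip1 ip e (f t) (g t)) (at p) a =
      ip1 ip e (?u a) (g p) + ip1 ip e (f p) (?v a)"
    by (simp flip: frechet_derivative_at)
  then show ?thesis
    by (simp add: derivative_ip_def increment_def ip1_left_diff_distrib ip1_right_diff_distrib)
qed

text \<open>Lets the derivative chosen for a sum or a multiple be replaced by the sum or multiple of
  the chosen derivatives.\<close>

lemma snorm_increment_diff:
  assumes "f \<in> diff_near p" "has_deriv f u p"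
  shows "snorm (increment p a f - (u a - f p)) = 0"
  using has_deriv_unique[OF has_deriv_module_derivative[OF assms(1)] assms(2), of a]
  by (simp add: increment_def)

lemma derivative_ip_add_right:
  assumes f: "f \<in> diff_near p" and g: "g \<in> diff_near p" and h: "h \<in> diff_near p"
  shows "derivative_ip scaleX ip e p a f (g + h) =
    derivative_ip scaleX ip e p a f g + derivative_ip scaleX ip e p a f h"
proof -
  have "snorm (increment p a (g + h) - (increment p a g + increment p a h)) = 0"
    using snorm_increment_diff[OF diff_near_add[OF g h], of _ a]
      has_deriv_add[OF has_deriv_module_derivative[OF g] has_deriv_module_derivative[OF h]]
    by (fastforce simp: increment_def plus_fun_def algebra_simps)
  then show ?thesis
    using ip1_cong_right by (simp add: derivative_ip_eq f g h diff_near_add flip: ip1_right_distrib)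
qed

lemma derivative_ip_act_right:
  assumes f: "f \<in> diff_near p" and g: "g \<in> diff_near p"
  shows "derivative_ip scaleX ip e p a f (\<lambda>t. act (g t) b) = derivative_ip scaleX ip e p a f g * b"
proof -
  have "snorm (increment p a (\<lambda>t. act (g t) b) - act (increment p a g) b) = 0"
    using snorm_increment_diff[OF diff_near_act[OF g]
        has_deriv_act[OF has_deriv_module_derivative[OF g]], of a b]
    by (simp add: increment_def act_diff_left)
  then show ?thesis
    using ip1_cong_right by (simp add: derivative_ip_eq f g diff_near_act flip: ip1_act_right)
qed

end

theorem theorem3:
  fixes scaleX :: "complex \<Rightarrow> 'x::ab_group_add \<Rightarrow> 'x"
    and act :: "'x \<Rightarrow> 'a::cstar_algebra \<Rightarrow> 'x"
    and ip :: "'x \<Rightarrow> 'x \<Rightarrow> 'a"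
    and p :: 'a and e :: 'x
  assumes "semi_inner_product_cstar_module scaleX UNIV act ip"
    and "ip e e * ip e e = ip e e"
  shows "\<forall>a. semi_inner_product_cstar_module
           (\<lambda>c f t. scaleX c (f t)) (differentiable_near scaleX ip p)
           (\<lambda>f b t. act (f t) b) (derivative_ip scaleX ip e p a)"
proof
  fix a
  interpret total_semi_inner_product_cstar_module scaleX act ip
    using assms(1) by (rule total_semi_inner_product_cstar_module.intro)
  interpret fun_space: vector_space "\<lambda>c f t. scaleX c (f t) :: 'x"
    by standard (simp_all add: fun_eq_iff scale_right_distrib scale_left_distrib)
  show "semi_inner_product_cstar_module (\<lambda>c f t. scaleX c (f t)) (diff_near p)
      (\<lambda>f b t. act (f t) b) (derivative_ip scaleX ip e p a)"
  proof
    show "fun_space.subspace (diff_near p)"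
      by (simp add: fun_space.subspace_def diff_near_zero diff_near_add diff_near_scale)
  \<comment> \<open>\<open>derivative_ip_eq\<close> reduces symmetry and positivity to
    \<open>star_ip1\<close> and \<open>ip1_nonneg\<close> at increments.\<close>
  qed (simp_all add: diff_near_act fun_eq_iff act_add_left act_add_right act_mult act_scale_left
      act_scale_right derivative_ip_add_right derivative_ip_act_right derivative_ip_eq star_ip1
      ip1_nonneg assms(2))
qed

end
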